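(* For $n \ge 0$ let $g_n$ be the number of strongly graded $(\mathbf{3+1})$-avoiding posets on the vertex set $[n]=\{1,\dots,n\}$ (so $g_0=1$). Let $$\Psi(x)=\sum_{m,n\ge 0}\frac{2^{mn}x^{m+n}}{m!\,n!}.$$ Then $$\sum_{n\ge 0} g_n\frac{x^n}{n!} \;=\; 1+\frac{e^{2x}(2e^x-3)+e^x(e^x-2)^2\Psi(x)}{e^x(2e^x+1)+(e^{2x}-2e^x-1)\Psi(x)}$$ as formal power series.
   Context: All posets are finite; a poset on $[n]$ is a partial order on the labeled set $[n]$, and two such posets are different if their order relations differ. A poset $P$ is weakly graded if there is a function $\operatorname{rk}:P\to\mathbb{N}$ such that $\operatorname{rk}(b)=\operatorname{rk}(a)+1$ whenever $b$ covers $a$, and such that the minimum value of $\operatorname{rk}$ on each connected component of $P$ is $0$. A weakly graded poset is strongly graded if all its minimal elements have the same rank and all its maximal elements have the same rank. A poset is $(\mathbf{3+1})$-avoiding if there are no four elements $x,y,z,w$ with $x<y<z$ and $w$ incomparable to each of $x,y,z$. *)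

theory Defs
  imports "HOL-Computational_Algebra.Formal_Power_Series"
begin

text \<open>
  A poset is a carrier \<open>A\<close> with its reflexive order relation \<open>r\<close>, i.e.
  \<open>partial_order_on A r\<close>; in particular \<open>r \<subseteq> A \<times> A\<close>, so distinct relations are distinct
  posets on \<open>A\<close>.
\<close>

definition less_in :: "'a rel \<Rightarrow> 'a \<Rightarrow> 'a \<Rightarrow> bool" where
  "less_in r a b \<longleftrightarrow> (a, b) \<in> r \<and> a \<noteq> b"

definition covered_by :: "'a set \<Rightarrow> 'a rel \<Rightarrow> 'a \<Rightarrow> 'a \<Rightarrow> bool" where
  "covered_by A r a b \<longleftrightarrow> less_in r a b \<and> \<not> (\<exists>c\<in>A. less_in r a c \<and> less_in r c b)"

definition minimal_in :: "'a set \<Rightarrow> 'a rel \<Rightarrow> 'a \<Rightarrow> bool" where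
  "minimal_in A r a \<longleftrightarrow> a \<in> A \<and> \<not> (\<exists>b\<in>A. less_in r b a)"

definition maximal_in :: "'a set \<Rightarrow> 'a rel \<Rightarrow> 'a \<Rightarrow> bool" where
  "maximal_in A r a \<longleftrightarrow> a \<in> A \<and> \<not> (\<exists>b\<in>A. less_in r a b)"

definition incomparable :: "'a rel \<Rightarrow> 'a \<Rightarrow> 'a \<Rightarrow> bool" where
  "incomparable r a b \<longleftrightarrow> (a, b) \<notin> r \<and> (b, a) \<notin> r"

text \<open>Connected components of the comparability graph (equivalently, of the Hasse diagram).\<close>

definition components :: "'a set \<Rightarrow> 'a rel \<Rightarrow> 'a set set" where
  "components A r = A // (r \<union> r\<inverse>)\<^sup>*"

text \<open>Only the values of \<open>rk\<close> on \<open>A\<close> matter.\<close>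

definition rank_function :: "'a set \<Rightarrow> 'a rel \<Rightarrow> ('a \<Rightarrow> nat) \<Rightarrow> bool" where
  "rank_function A r rk \<longleftrightarrow>
     (\<forall>a\<in>A. \<forall>b\<in>A. covered_by A r a b \<longrightarrow> rk b = rk a + 1) \<and>
     (\<forall>C\<in>components A r. Min (rk ` C) = 0)"

definition weakly_graded :: "'a set \<Rightarrow> 'a rel \<Rightarrow> bool" where
  "weakly_graded A r \<longleftrightarrow> (\<exists>rk. rank_function A r rk)"

text \<open>
  The rank function of a finite poset is unique on the carrier if it exists, so the
  existential quantifier below speaks about the rank function of a weakly graded poset.
\<close>

definition strongly_graded :: "'a set \<Rightarrow> 'a rel \<Rightarrow> bool" where
  "strongly_graded A r \<longleftrightarrow>
     (\<exists>rk. rank_function A r rk \<and>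
       (\<forall>a b. minimal_in A r a \<and> minimal_in A r b \<longrightarrow> rk a = rk b) \<and>
       (\<forall>a b. maximal_in A r a \<and> maximal_in A r b \<longrightarrow> rk a = rk b))"

lemma strongly_graded_imp_weakly_graded: "strongly_graded A r \<Longrightarrow> weakly_graded A r"
  by (auto simp: strongly_graded_def weakly_graded_def)

definition avoids_3_plus_1 :: "'a set \<Rightarrow> 'a rel \<Rightarrow> bool" where
  "avoids_3_plus_1 A r \<longleftrightarrow>
     \<not> (\<exists>x\<in>A. \<exists>y\<in>A. \<exists>z\<in>A. \<exists>w\<in>A. less_in r x y \<and> less_in r y z \<and>
          incomparable r w x \<and> incomparable r w y \<and> incomparable r w z)"

definition num_strongly_graded :: "nat \<Rightarrow> nat" where
  "num_strongly_graded n =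
     card {r. partial_order_on {1..n} r \<and> strongly_graded {1..n} r \<and> avoids_3_plus_1 {1..n} r}"

text \<open>The double series is collected by powers of the variable; each inner sum is finite.\<close>

definition Psi :: "rat fps" where
  "Psi = Abs_fps (\<lambda>k. \<Sum>(m, n) | m + n = k. 2 ^ (m * n) / (fact m * fact n))"

lemma num_strongly_graded_0: "num_strongly_graded 0 = 1"
proof -
  have "{r :: nat rel. partial_order_on {} r \<and> strongly_graded {} r \<and> avoids_3_plus_1 {} r} = {{}}"
    by (auto simp: partial_order_on_def preorder_on_def refl_on_def trans_def antisym_def
        strongly_graded_def rank_function_def components_def quotient_def minimal_in_def
        maximal_in_def avoids_3_plus_1_def)
  then show ?thesis
    by (simp add: num_strongly_graded_def)
qed

text \<open>
  The denominator of the generating function has constant term 1, so division by it is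
  multiplication by its inverse power series.
\<close>

lemma denominator_nth_0:
  "fps_nth (fps_exp 1 * (2 * fps_exp 1 + 1) + (fps_exp 2 - 2 * fps_exp 1 - 1) * Psi) 0 = 1"
proof -
  have "{(m, n). m + n = (0::nat)} = {(0, 0)}"
    by auto
  then have "fps_nth Psi 0 = 1"
    by (simp add: Psi_def)
  then show ?thesis
    by simp
qed

end

(*
  In a strongly graded (3+1)-avoiding poset any two elements at least two ranks apart are
  comparable, so the poset is determined by its rank function and the relation Q of incomparable
  pairs in adjacent ranks. Avoiding 3+1 then means that Domain Q and Range Q are disjoint, and
  strong gradedness becomes a condition on each single rank, which depends only on the parts of Q
  just below and just above it, and on these only through one bit each. Removing the bottom rank
  therefore gives a linear recursion with two states. Its coefficients count relations with
  prescribed domain and range, with or without full rows and columns; their generating functions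
  are of the form A + B Psi with A and B Laurent polynomials in e^x. Solving the 2x2 linear system
  for the sum over all numbers of ranks gives the formula.
*)

theory Submission
  imports Defs
begin

text \<open>Call \<open>c\<close> a link between \<open>a\<close> and \<open>b\<close> if neither
  \<open>(a, c)\<close> nor \<open>(c, b)\<close> is a gap. Strong gradedness amounts to links in
  every rank between anything below and anything above it. By disjointness an element of
  \<open>Range Q\<close> has no gap upwards and one of \<open>Domain Q\<close> none downwards. So a
  rank fails only if it has no element outside \<open>Field Q\<close>, a single \<open>a\<close> has
  gaps to all its elements in \<open>Range Q\<close>, and a single \<open>b\<close> has gaps to all
  its elements in \<open>Domain Q\<close>. These \<open>a\<close> and \<open>b\<close> are chosen
  independently, hence one bit for each side: is there a full row below, is there a full column
  above. The bottom rank can take the upper ends of its gaps along when it is removed: they have no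
  gaps upwards, so the remaining ranks notice them only through that bit. All coefficients of the
  linear system involve \<open>Psi\<close>, so its determinant could contain the square of
  \<open>Psi\<close>; these terms cancel, and the result is a quotient of expressions linear in
  \<open>Psi\<close>.\<close>

subsection \<open>Posets encoded by their gaps\<close>

text \<open>
  \<open>Q\<close> is nonempty, and in the bipartite graph of the pairs of \<open>Domain Q \<times> Range Q\<close> that are
  \<^emph>\<open>not\<close> in \<open>Q\<close> every left vertex has a neighbour; the right-hand counterpart is \<open>lgood (Q\<inverse>)\<close>.
\<close>

definition lgood :: "'a rel \<Rightarrow> bool" where
  "lgood Q \<longleftrightarrow> Q \<noteq> {} \<and> (\<forall>a\<in>Domain Q. Q `` {a} \<noteq> Range Q)"

definition layer :: "('a \<Rightarrow> nat) \<Rightarrow> 'a rel \<Rightarrow> nat \<Rightarrow> 'a rel" where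
  "layer rk Q j = {(a, b) \<in> Q. rk b = j}"

definition level_ok :: "bool \<Rightarrow> 'a set \<Rightarrow> ('a \<Rightarrow> nat) \<Rightarrow> 'a rel \<Rightarrow> nat \<Rightarrow> bool" where
  "level_ok \<alpha> A rk Q j \<longleftrightarrow> (\<exists>f\<in>A. rk f = j \<and> f \<notin> Field Q) \<or> (j = 0 \<and> \<alpha>) \<or>
     lgood (layer rk Q j) \<or> lgood ((layer rk Q (Suc j))\<inverse>)"

text \<open>
  \<open>(rk, Q)\<close> encodes the poset with rank function \<open>rk\<close> and top rank \<open>k\<close> in which \<open>a < b\<close> iff
  \<open>rk a < rk b\<close> and \<open>(a, b) \<notin> Q\<close>; so \<open>Q\<close> consists of the incomparable pairs in adjacent ranks.
  The flag \<open>\<alpha>\<close> waives the condition on rank 0; it is set for what remains after the bottom rank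
  and its gaps to rank 1 have been removed, if those gaps already satisfy the condition on rank 1.
\<close>

definition gap_structures :: "nat \<Rightarrow> bool \<Rightarrow> 'a set \<Rightarrow> (('a \<Rightarrow> nat) \<times> 'a rel) set" where
  "gap_structures k \<alpha> A = {(rk, Q). (\<forall>a. a \<notin> A \<longrightarrow> rk a = 0) \<and> (\<forall>a\<in>A. rk a \<le> k) \<and>
     Q \<subseteq> A \<times> A \<and> (\<forall>(a, b)\<in>Q. rk b = Suc (rk a)) \<and> Domain Q \<inter> Range Q = {} \<and>
     (\<forall>j\<le>k. level_ok \<alpha> A rk Q j)}"

lemma gap_structuresD:
  assumes "(rk, Q) \<in> gap_structures k \<alpha> A"
  shows "a \<notin> A \<Longrightarrow> rk a = 0" "a \<in> A \<Longrightarrow> rk a \<le> k" "Q \<subseteq> A \<times> A"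
    "(a, b) \<in> Q \<Longrightarrow> rk b = Suc (rk a)" "Domain Q \<inter> Range Q = {}"
    "j \<le> k \<Longrightarrow> level_ok \<alpha> A rk Q j"
  using assms by (auto simp: gap_structures_def)

text \<open>On the right \<open>a\<close> is unrestricted: any \<open>a\<close> serves for empty
  \<open>Q\<close>, and for nonempty \<open>Q\<close> being related to all of \<open>Range Q\<close>
  puts \<open>a\<close> into \<open>Domain Q\<close>. An empty layer thus counts as bad, as it
  should: it supplies no link.\<close>

lemma not_lgood: "\<not> lgood Q \<longleftrightarrow> (\<exists>a. \<forall>c\<in>Range Q. (a, c) \<in> Q)"
proof
  assume "\<not> lgood Q"
  then show "\<exists>a. \<forall>c\<in>Range Q. (a, c) \<in> Q"
    unfolding lgood_def by blast
next
  assume "\<exists>a. \<forall>c\<in>Range Q. (a, c) \<in> Q"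
  then obtain a where a: "\<forall>c\<in>Range Q. (a, c) \<in> Q" ..
  then have "Q `` {a} = Range Q" by blast
  moreover have "a \<in> Domain Q" if "Q \<noteq> {}"
    using a that by auto
  ultimately show "\<not> lgood Q" unfolding lgood_def by blast
qed

text \<open>
  This is the form in which the condition is used: every rank contains a link between any element
  below it and any element above it. The points \<open>a\<close> and \<open>b\<close> may lie anywhere, which also covers
  the existence of upper and lower covers and the nonemptiness of the rank.
\<close>

lemma level_ok_False_iff:
  assumes "Q \<subseteq> A \<times> A" "\<And>a b. (a, b) \<in> Q \<Longrightarrow> rk b = Suc (rk a)" "Domain Q \<inter> Range Q = {}"
  shows "level_ok False A rk Q j \<longleftrightarrow>
    (\<forall>a b. \<exists>c\<in>A. rk c = j \<and> (a, c) \<notin> Q \<and> (c, b) \<notin> Q)"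
proof
  assume ok: "level_ok False A rk Q j"
  show "\<forall>a b. \<exists>c\<in>A. rk c = j \<and> (a, c) \<notin> Q \<and> (c, b) \<notin> Q"
  proof (intro allI)
    fix a b
    consider (F) "\<exists>f\<in>A. rk f = j \<and> f \<notin> Field Q" | (L) "lgood (layer rk Q j)"
      | (R) "lgood ((layer rk Q (Suc j))\<inverse>)"
      using ok by (auto simp: level_ok_def)
    then show "\<exists>c\<in>A. rk c = j \<and> (a, c) \<notin> Q \<and> (c, b) \<notin> Q"
    proof cases
      case F
      then show ?thesis by (auto simp: Field_def)
    next
      case L
      then obtain c where "c \<in> Range (layer rk Q j)" "(a, c) \<notin> layer rk Q j"
        using not_lgood by blast
      then have "c \<in> Range Q" "rk c = j" "(a, c) \<notin> Q" by (auto simp: layer_def)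
      \<comment> \<open>As an element of \<open>Range Q\<close>, \<open>c\<close> lies outside
        \<open>Domain Q\<close>, so \<open>(c, b)\<close> is not a gap whatever \<open>b\<close>
        is.\<close>
      then show ?thesis using assms(1,3) by blast
    next
      case R
      then obtain c where c: "c \<in> Domain (layer rk Q (Suc j))" "(c, b) \<notin> layer rk Q (Suc j)"
        using not_lgood by (metis Range_converse converse_iff)
      then have "rk c = j" using assms(2) by (force simp: layer_def)
      moreover have "c \<in> Domain Q" "(c, b) \<notin> Q"
        using c \<open>rk c = j\<close> assms(2) by (auto simp: layer_def)
      ultimately show ?thesis using assms(1,3) by blast
    qed
  qed
next
  assume mid: "\<forall>a b. \<exists>c\<in>A. rk c = j \<and> (a, c) \<notin> Q \<and> (c, b) \<notin> Q"
  show "level_ok False A rk Q j"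
  proof (rule ccontr)
    assume no: "\<not> level_ok False A rk Q j"
    \<comment> \<open>The two bad layers supply a worst \<open>a\<close> and a worst
      \<open>b\<close>. A link between these two can lie neither in \<open>Range Q\<close> nor in
      \<open>Domain Q\<close>.\<close>
    then obtain a where a: "\<forall>c\<in>Range (layer rk Q j). (a, c) \<in> layer rk Q j"
      using not_lgood by (metis level_ok_def)
    obtain b where b: "\<forall>c\<in>Domain (layer rk Q (Suc j)). (c, b) \<in> layer rk Q (Suc j)"
      using not_lgood no by (metis Range_converse converse_iff level_ok_def)
    obtain c where c: "c \<in> A" "rk c = j" "(a, c) \<notin> Q" "(c, b) \<notin> Q"
      using mid by blast
    have "c \<notin> Range Q" using a c by (auto simp: layer_def)
    moreover have "c \<notin> Domain Q"
    proof
      assume "c \<in> Domain Q"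
      then obtain d where "(c, d) \<in> Q" by blast
      moreover from this have "rk d = Suc j" using assms(2) c by simp
      ultimately show False using b c by (auto simp: layer_def)
    qed
    ultimately show False using no c by (auto simp: level_ok_def Field_def)
  qed
qed

lemma gap_structures_mid:
  assumes "(rk, Q) \<in> gap_structures k False A" "j \<le> k"
  obtains c where "c \<in> A" "rk c = j" "(a, c) \<notin> Q" "(c, b) \<notin> Q"
  using level_ok_False_iff[of Q A rk j] gap_structuresD[OF assms(1)] assms(2) by metis

section \<open>From gap structures to posets\<close>

definition order_of :: "'a set \<Rightarrow> ('a \<Rightarrow> nat) \<times> 'a rel \<Rightarrow> 'a rel" where
  "order_of A = (\<lambda>(rk, Q). {(a, b). a \<in> A \<and> b \<in> A \<and> (a = b \<or> rk a < rk b \<and> (a, b) \<notin> Q)})"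

lemma less_in_order_of:
  "less_in (order_of A (rk, Q)) a b \<longleftrightarrow> a \<in> A \<and> b \<in> A \<and> rk a < rk b \<and> (a, b) \<notin> Q"
  by (auto simp: less_in_def order_of_def)

text \<open>Transitivity holds because the ends of a strict chain of three are at least two ranks
  apart, while a gap joins adjacent ranks.\<close>

lemma partial_order_on_order_of:
  assumes "(rk, Q) \<in> gap_structures k \<alpha> A"
  shows "partial_order_on A (order_of A (rk, Q))"
proof -
  have "trans (order_of A (rk, Q))"
  proof (rule transI)
    fix x y z assume "(x, y) \<in> order_of A (rk, Q)" "(y, z) \<in> order_of A (rk, Q)"
    then show "(x, z) \<in> order_of A (rk, Q)"
      using gap_structuresD(4)[OF assms, of x z] by (auto simp: order_of_def)
  qed
  then show ?thesis
    by (auto simp: partial_order_on_def preorder_on_def refl_on_def antisym_def order_of_def)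
qed

lemma component_contains:
  assumes "C \<in> components A r" "a \<in> C" "(b, a) \<in> r \<or> (a, b) \<in> r"
  shows "b \<in> C"
proof -
  obtain x where "C = (r \<union> r\<inverse>)\<^sup>* `` {x}" using assms(1) by (auto simp: components_def quotient_def)
  moreover have "(a, b) \<in> r \<union> r\<inverse>" using assms(3) by auto
  ultimately show ?thesis using assms(2) by (auto intro: rtrancl_into_rtrancl)
qed

lemma component_subset:
  assumes "C \<in> components A r" "r \<subseteq> A \<times> A"
  shows "C \<subseteq> A" "C \<noteq> {}"
proof -
  obtain x where x: "C = (r \<union> r\<inverse>)\<^sup>* `` {x}" "x \<in> A"
    using assms(1) by (auto simp: components_def quotient_def)
  show "C \<noteq> {}" using x by auto
  show "C \<subseteq> A"
  proof
    fix y assume "y \<in> C"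
    then have "(x, y) \<in> (r \<union> r\<inverse>)\<^sup>*" using x by auto
    then show "y \<in> A"
      by (cases rule: rtranclE) (use x assms(2) in auto)
  qed
qed

lemma in_some_component:
  assumes "a \<in> A"
  obtains C where "C \<in> components A r" "a \<in> C"
  using assms by (auto simp: components_def quotient_def)

text \<open>A link in the rank just above \<open>a\<close> separates \<open>a\<close> from anything
  two or more ranks higher, so covers raise the rank by one. A link in the rank just below an
  element of positive rank stays in its component, so the minimum is 0.\<close>

lemma rank_function_order_of:
  assumes "finite A" and S: "(rk, Q) \<in> gap_structures k False A"
  shows "rank_function A (order_of A (rk, Q)) rk"
  unfolding rank_function_def
proof (intro conjI ballI impI)
  let ?r = "order_of A (rk, Q)"
  fix a b assume ab: "a \<in> A" "b \<in> A" "covered_by A ?r a b"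
  then have lt: "rk a < rk b" and nc: "\<not> (\<exists>c\<in>A. less_in ?r a c \<and> less_in ?r c b)"
    by (auto simp: covered_by_def less_in_order_of)
  show "rk b = rk a + 1"
  proof (rule ccontr)
    assume "rk b \<noteq> rk a + 1"
    then have far: "Suc (rk a) < rk b" using lt by simp
    then have "Suc (rk a) \<le> k" using gap_structuresD(2)[OF S, of b] ab by simp
    from gap_structures_mid[OF S this, of a b] obtain c
      where "c \<in> A" "rk c = Suc (rk a)" "(a, c) \<notin> Q" "(c, b) \<notin> Q" by metis
    then show False using nc far ab by (auto simp: less_in_order_of)
  qed
next
  let ?r = "order_of A (rk, Q)"
  fix C assume C: "C \<in> components A ?r"
  have CA: "C \<subseteq> A" "C \<noteq> {}"
    using component_subset[OF C] by (auto simp: order_of_def)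
  then have fin: "finite C" using assms(1) finite_subset by blast
  define m where "m = Min (rk ` C)"
  have "m \<in> rk ` C" unfolding m_def using CA fin by simp
  then obtain b where b: "b \<in> C" "rk b = m" by auto
  have "m = 0"
  proof (rule ccontr)
    assume "m \<noteq> 0"
    then obtain j where j: "m = Suc j" using not0_implies_Suc by blast
    then have "j \<le> k" using gap_structuresD(2)[OF S, of b] b CA by auto
    \<comment> \<open>Only the upper end matters; \<open>b\<close> also fills the place of the lower
      end, which may be arbitrary.\<close>
    from gap_structures_mid[OF S this, of b b] obtain c where
      c: "c \<in> A" "rk c = j" "(c, b) \<notin> Q" by metis
    then have "(c, b) \<in> ?r" using b CA j by (auto simp: order_of_def)
    then have "c \<in> C" using component_contains[OF C b(1)] by blast
    then have "m \<le> j" unfolding m_def using c fin by auto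
    then show False using j by simp
  qed
  then show "Min (rk ` C) = 0" by (simp add: m_def)
qed

lemma strongly_graded_order_of:
  assumes "finite A" and S: "(rk, Q) \<in> gap_structures k False A"
  shows "strongly_graded A (order_of A (rk, Q))"
proof -
  let ?r = "order_of A (rk, Q)"
  have min: "rk a = 0" if a: "minimal_in A ?r a" for a
  proof (rule ccontr)
    assume "rk a \<noteq> 0"
    then obtain j where j: "rk a = Suc j" using not0_implies_Suc by blast
    have "a \<in> A" using a by (simp add: minimal_in_def)
    then have "j \<le> k" using gap_structuresD(2)[OF S, of a] j by auto
    from gap_structures_mid[OF S this, of a a] show False
      using a j by (metis \<open>a \<in> A\<close> lessI less_in_order_of minimal_in_def)
  qed
  have max: "rk a = k" if a: "maximal_in A ?r a" for a
  proof (rule ccontr)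
    assume "rk a \<noteq> k"
    moreover have "a \<in> A" using a by (simp add: maximal_in_def)
    ultimately have "Suc (rk a) \<le> k" using gap_structuresD(2)[OF S, of a] by auto
    from gap_structures_mid[OF S this, of a a] show False
      using a by (metis \<open>a \<in> A\<close> lessI less_in_order_of maximal_in_def)
  qed
  show ?thesis
    unfolding strongly_graded_def using rank_function_order_of[OF assms] min max by fastforce
qed

text \<open>Elements incomparable to \<open>w\<close> are within one rank of it. A chain of three of
  them therefore occupies the ranks just below, at and just above \<open>w\<close>, which makes
  \<open>w\<close> the upper end of one gap and the lower end of another.\<close>

lemma avoids_order_of:
  assumes S: "(rk, Q) \<in> gap_structures k False A"
  shows "avoids_3_plus_1 A (order_of A (rk, Q))"
  unfolding avoids_3_plus_1_def
proof clarify
  let ?r = "order_of A (rk, Q)"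
  fix x y z w assume el: "x \<in> A" "y \<in> A" "z \<in> A" "w \<in> A"
    and lt: "less_in ?r x y" "less_in ?r y z"
    and inc: "incomparable ?r w x" "incomparable ?r w y" "incomparable ?r w z"
  have near: "rk u = rk w \<or> (u, w) \<in> Q \<and> rk w = Suc (rk u) \<or> (w, u) \<in> Q \<and> rk u = Suc (rk w)"
    if "u \<in> A" "incomparable ?r w u" for u
  proof -
    have "rk w < rk u \<Longrightarrow> (w, u) \<in> Q" "rk u < rk w \<Longrightarrow> (u, w) \<in> Q"
      using that el by (auto simp: incomparable_def order_of_def)
    then show ?thesis using gap_structuresD(4)[OF S] by (metis linorder_neqE_nat)
  qed
  have "rk x < rk y" "rk y < rk z" using lt by (auto simp: less_in_order_of)
  with near[OF el(1) inc(1)] near[OF el(2) inc(2)] near[OF el(3) inc(3)]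
  have "(x, w) \<in> Q \<and> (w, z) \<in> Q"
    by (elim disjE conjE) simp_all
  then show False using gap_structuresD(5)[OF S] by blast
qed

section \<open>Uniqueness of the encoding\<close>

text \<open>Induction on \<open>rk a\<close>: rank 0 means minimal in the common order, and
  otherwise some \<open>c\<close> one rank lower lies below \<open>a\<close>. If \<open>rk'\<close>
  rose by more than one from \<open>c\<close> to \<open>a\<close>, a link for \<open>rk'\<close>
  would lie strictly between them, and \<open>rk\<close> leaves no room for it.\<close>

lemma gap_structure_rank_unique:
  assumes S: "(rk, Q) \<in> gap_structures k False A" and S': "(rk', Q') \<in> gap_structures k' False A"
    and eq: "order_of A (rk, Q) = order_of A (rk', Q')" and a: "a \<in> A"
  shows "rk a = rk' a"
  using a
proof (induction "rk a" arbitrary: a)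
  case 0
  show ?case
  proof (rule ccontr)
    assume "rk a \<noteq> rk' a"
    then obtain j where j: "rk' a = Suc j" using 0 by (metis not0_implies_Suc)
    then have "j \<le> k'" using gap_structuresD(2)[OF S', of a] 0 by auto
    from gap_structures_mid[OF S' this, of a a] obtain c where
      "less_in (order_of A (rk', Q')) c a" using j 0(2) less_in_order_of by (metis lessI)
    then show False using eq 0 by (metis less_in_order_of not_less_zero)
  qed
next
  case (Suc j)
  then have "j \<le> k" using gap_structuresD(2)[OF S, of a] by auto
  from gap_structures_mid[OF S this, of a a] obtain c where
    c: "c \<in> A" "rk c = j" "(c, a) \<notin> Q" by metis
  have "less_in (order_of A (rk, Q)) c a" using c Suc by (auto simp: less_in_order_of)
  then have lt': "rk' c < rk' a" using eq by (metis less_in_order_of)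
  have "rk' a = Suc (rk' c)"
  proof (rule ccontr)
    assume "rk' a \<noteq> Suc (rk' c)"
    then have far: "Suc (rk' c) < rk' a" using lt' by simp
    then have "Suc (rk' c) \<le> k'" using gap_structuresD(2)[OF S', of a] Suc by simp
    from gap_structures_mid[OF S' this, of c a] obtain d
      where "d \<in> A" "rk' d = Suc (rk' c)" "(c, d) \<notin> Q'" "(d, a) \<notin> Q'" by metis
    then have "less_in (order_of A (rk', Q')) c d" "less_in (order_of A (rk', Q')) d a"
      using c Suc far by (auto simp: less_in_order_of)
    then have "rk c < rk d" "rk d < rk a" by (metis eq less_in_order_of)+
    then show False using c Suc by simp
  qed
  then show ?case using Suc c by metis
qed

lemma inj_on_order_of: "inj_on (order_of A) (\<Union>k. gap_structures k False A)"
proof (rule inj_onI, clarify)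
  fix rk Q k rk' Q' k'
  assume S: "(rk, Q) \<in> gap_structures k False A" and S': "(rk', Q') \<in> gap_structures k' False A"
    and eq: "order_of A (rk, Q) = order_of A (rk', Q')"
  have "rk a = rk' a" for a
    using gap_structure_rank_unique[OF S S' eq] gap_structuresD(1)[OF S] gap_structuresD(1)[OF S']
    by (cases "a \<in> A") auto
  then have rk: "rk = rk'" by blast
  have mem: "(a, b) \<in> Q \<longleftrightarrow> a \<in> A \<and> b \<in> A \<and> rk b = Suc (rk a) \<and> (a, b) \<notin> order_of A (rk, Q)"
    if "(rk, Q) \<in> gap_structures k False A" for Q k a b
  proof -
    have "(a, b) \<in> Q \<Longrightarrow> a \<in> A \<and> b \<in> A \<and> rk b = Suc (rk a)"
      using gap_structuresD(3,4)[OF that] by blast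
    then show ?thesis by (auto simp: order_of_def)
  qed
  have "Q = Q'" using mem[OF S] mem[OF S'[folded rk]] eq[folded rk] by auto
  with rk show "rk = rk' \<and> Q = Q'" by simp
qed

section \<open>Every poset of the class is encoded\<close>

text \<open>Replaces saturated chains: facts about covers pass to all strict pairs, by induction on
  the number of elements strictly between.\<close>

lemma less_in_cover_induct [consumes 3, case_names cover trans]:
  assumes "finite A" "partial_order_on A r" "less_in r a b"
    and cover: "\<And>a b. covered_by A r a b \<Longrightarrow> P a b"
    and trans: "\<And>a b c. less_in r a c \<Longrightarrow> less_in r c b \<Longrightarrow> P a c \<Longrightarrow> P c b \<Longrightarrow> P a b"
  shows "P a b"
  using assms(3)
proof (induction "card {c \<in> A. less_in r a c \<and> less_in r c b}" arbitrary: a b rule: less_induct)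
  case less
  have tr: "less_in r x z" if "less_in r x y" "less_in r y z" for x y z
    using that assms(2) unfolding less_in_def partial_order_on_def preorder_on_def
    by (metis antisymD transD)
  show ?case
  proof (cases "covered_by A r a b")
    case False
    then obtain c where c: "c \<in> A" "less_in r a c" "less_in r c b"
      using less.prems by (auto simp: covered_by_def)
    have irr: "\<not> less_in r c c" by (simp add: less_in_def)
    have "{d \<in> A. less_in r a d \<and> less_in r d c} \<subset> {d \<in> A. less_in r a d \<and> less_in r d b}"
      "{d \<in> A. less_in r c d \<and> less_in r d b} \<subset> {d \<in> A. less_in r a d \<and> less_in r d b}"
      using c irr tr by blast+
    then have "P a c" "P c b"
      using less.hyps c assms(1) by (simp_all add: psubset_card_mono)
    then show ?thesis using trans c by blast
  qed (rule cover)
qed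

text \<open>The code of \<open>r\<close> is its rank function together with the incomparable pairs
  in adjacent ranks. Avoidance enters twice, in \<open>two\<close> for comparability two ranks apart
  and in \<open>disj\<close>; strong gradedness enters through \<open>min_0\<close> and
  \<open>max_k\<close>.\<close>

lemma order_of_surj:
  assumes fin: "finite A" and ne: "A \<noteq> {}" and po: "partial_order_on A r"
    and sg: "strongly_graded A r" and av: "avoids_3_plus_1 A r"
  shows "r \<in> order_of A ` (\<Union>k. gap_structures k False A)"
proof -
  obtain rk where rf: "rank_function A r rk"
    and min_eq: "\<And>a b. minimal_in A r a \<Longrightarrow> minimal_in A r b \<Longrightarrow> rk a = rk b"
    and max_eq: "\<And>a b. maximal_in A r a \<Longrightarrow> maximal_in A r b \<Longrightarrow> rk a = rk b"
    using sg unfolding strongly_graded_def by metis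
  have rA: "r \<subseteq> A \<times> A" and refl: "\<And>a. a \<in> A \<Longrightarrow> (a, a) \<in> r"
    and trr: "\<And>x y z. (x, y) \<in> r \<Longrightarrow> (y, z) \<in> r \<Longrightarrow> (x, z) \<in> r"
    and asym: "\<And>x y. (x, y) \<in> r \<Longrightarrow> (y, x) \<in> r \<Longrightarrow> x = y"
    using po unfolding partial_order_on_def preorder_on_def refl_on_def trans_def antisym_def
    by blast+
  have lA: "a \<in> A" "b \<in> A" if "less_in r a b" for a b using that rA by (auto simp: less_in_def)
  have cov: "rk b = Suc (rk a)" if "covered_by A r a b" for a b
    using that rf lA unfolding rank_function_def covered_by_def by auto
  have lt: "rk a < rk b" if "less_in r a b" for a b
    using fin po that by (induction rule: less_in_cover_induct) (auto dest: cov)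
  have first: "\<exists>c. less_in r a c \<and> rk c = Suc (rk a) \<and> (c, b) \<in> r" if "less_in r a b" for a b
    using fin po that
  proof (induction rule: less_in_cover_induct)
    case (cover a b)
    then show ?case using cov refl lA unfolding covered_by_def by blast
  qed (meson less_in_def trr)
  have last: "\<exists>c. less_in r c b \<and> rk b = Suc (rk c)" if "less_in r a b" for a b
    using fin po that
  proof (induction rule: less_in_cover_induct)
    case (cover a b)
    then show ?case using cov unfolding covered_by_def by blast
  qed
  \<comment> \<open>The component of \<open>a\<close> contains an element of rank 0. It is minimal
    since ranks increase along the order, and all minimal elements share one rank.\<close>
  have min_0: "rk a = 0" if a: "minimal_in A r a" for a
  proof -
    have "a \<in> A" using a by (simp add: minimal_in_def)
    then obtain C where C: "C \<in> components A r" "a \<in> C" by (rule in_some_component)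
    have CA: "C \<subseteq> A" using component_subset[OF C(1) rA] by blast
    then have "finite C" using fin finite_subset by blast
    moreover have m0: "Min (rk ` C) = 0" using rf C by (auto simp: rank_function_def)
    ultimately obtain c where c: "c \<in> C" "rk c = 0"
      by (metis C(2) Min_in empty_iff finite_imageI image_iff image_is_empty)
    then have "minimal_in A r c" using CA lt by (fastforce simp: minimal_in_def)
    then show ?thesis using min_eq a c by metis
  qed
  define k where "k = Max (rk ` A)"
  have le_k: "rk a \<le> k" if "a \<in> A" for a using that fin by (simp add: k_def)
  have "k \<in> rk ` A" unfolding k_def using fin ne by (intro Max_in) auto
  then obtain t where t: "t \<in> A" "rk t = k" by blast
  have max_k: "rk a = k" if "maximal_in A r a" for a
  proof -
    have "maximal_in A r t" using t lt le_k by (fastforce simp: maximal_in_def)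
    then show ?thesis using max_eq that t by metis
  qed
  have up: "\<exists>c. less_in r a c \<and> rk c = Suc (rk a)" if "a \<in> A" "rk a < k" for a
    using that max_k[of a] first by (fastforce simp: maximal_in_def)
  have down: "\<exists>c. less_in r c b \<and> rk b = Suc (rk c)" if "b \<in> A" "0 < rk b" for b
    using that min_0[of b] last by (fastforce simp: minimal_in_def)
  have inhabited: "\<exists>c\<in>A. rk c = j" if "j \<le> k" for j
    using that
  proof (induction rule: inc_induct)
    case base
    then show ?case using t by blast
  next
    case (step n)
    then obtain c where "c \<in> A" "rk c = Suc n" by blast
    then show ?case using down[of c] lA by fastforce
  qed
  \<comment> \<open>Otherwise descend twice from \<open>b\<close>, to \<open>c\<close> and then to
    \<open>d\<close> in the rank of \<open>a\<close>: the chain of \<open>d\<close>,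
    \<open>c\<close>, \<open>b\<close> together with \<open>a\<close> is a forbidden
    pattern.\<close>
  have two: "less_in r a b" if ab: "a \<in> A" "b \<in> A" "Suc (Suc (rk a)) = rk b" for a b
  proof (rule ccontr)
    assume n: "\<not> less_in r a b"
    obtain c where c: "less_in r c b" "rk b = Suc (rk c)" using down ab by (metis zero_less_Suc)
    obtain d where d: "less_in r d c" "rk c = Suc (rk d)"
      using down[of c] lA c ab by (metis Suc_inject zero_less_Suc)
    have same: "(x, y) \<notin> r" if "rk y \<le> rk x" "x \<noteq> y" for x y
      using lt[of x y] that by (auto simp: less_in_def)
    have nac: "(a, c) \<notin> r" using n c trr[of a c b] asym ab by (auto simp: less_in_def)
    have "a \<noteq> d" using nac d by (auto simp: less_in_def)
    moreover have "a \<noteq> c" "a \<noteq> b" using c ab by auto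
    ultimately have "incomparable r a d" "incomparable r a c" "incomparable r a b"
      using nac same c d ab n by (auto simp: incomparable_def less_in_def)
    moreover have "c \<in> A" "d \<in> A" using c d lA by blast+
    ultimately show False using av ab c(1) d(1) unfolding avoids_3_plus_1_def by blast
  qed
  \<comment> \<open>Climb from \<open>a\<close> and stop exactly two ranks below \<open>b\<close>;
    between adjacent ranks comparability may fail.\<close>
  have far: "less_in r a b" if "a \<in> A" "b \<in> A" "Suc (rk a) < rk b" for a b
    using that
  proof (induction "rk b - rk a" arbitrary: a rule: less_induct)
    case less
    show ?case
    proof (cases "Suc (Suc (rk a)) = rk b")
      case False
      obtain c where c: "less_in r a c" "rk c = Suc (rk a)"
        using up[of a] less.prems le_k[of b] by fastforce
      then have "less_in r c b" using False less.prems lA by (intro less.hyps) auto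
      then show ?thesis using c trr[of a c b] asym[of a c] by (auto simp: less_in_def)
    qed (use two less in blast)
  qed
  \<comment> \<open>The value 0 off \<open>A\<close> is the normal form that
    \<open>gap_structures\<close> requires; it keeps the code unique.\<close>
  define rk' where "rk' a = (if a \<in> A then rk a else 0)" for a
  define Q where "Q = {(a, b). a \<in> A \<and> b \<in> A \<and> rk b = Suc (rk a) \<and> (a, b) \<notin> r}"
  have rk'_A: "rk' a = rk a" if "a \<in> A" for a using that by (simp add: rk'_def)
  \<comment> \<open>For consecutive gaps \<open>(x, w)\<close> and \<open>(w, z)\<close>,
    \<open>far\<close> gives \<open>x\<close> below \<open>z\<close>. Some \<open>y\<close> between
    them lies in the rank of \<open>w\<close>, and \<open>x\<close>, \<open>y\<close>,
    \<open>z\<close> with \<open>w\<close> form a forbidden pattern.\<close>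
  have disj: "Domain Q \<inter> Range Q = {}"
  proof (rule ccontr)
    assume "Domain Q \<inter> Range Q \<noteq> {}"
    then obtain x w z where w: "(x, w) \<in> Q" "(w, z) \<in> Q" by blast
    then have "less_in r x z" by (intro far) (auto simp: Q_def)
    then obtain y where y: "less_in r x y" "rk y = Suc (rk x)" "(y, z) \<in> r" using first by blast
    have "y \<noteq> z" using y w by (auto simp: Q_def)
    then have yz: "less_in r y z" using y by (simp add: less_in_def)
    have "y \<noteq> w" using y w by (auto simp: Q_def less_in_def)
    then have "incomparable r w x" "incomparable r w y" "incomparable r w z"
      using w lt[of w x] lt[of w y] lt[of y w] lt[of z w] y
      by (auto simp: incomparable_def Q_def less_in_def)
    moreover have "x \<in> A" "y \<in> A" "z \<in> A" "w \<in> A" using w y(1) lA by (auto simp: Q_def)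
    ultimately show False using av y(1) yz unfolding avoids_3_plus_1_def by blast
  qed
  have "level_ok False A rk' Q j" if jk: "j \<le> k" for j
  proof (subst level_ok_False_iff)
    show "\<forall>a b. \<exists>c\<in>A. rk' c = j \<and> (a, c) \<notin> Q \<and> (c, b) \<notin> Q"
    proof (intro allI)
      fix a b
      \<comment> \<open>Gaps into or out of rank \<open>j\<close> involve only an \<open>a\<close>
        in rank \<open>j - 1\<close> or a \<open>b\<close> in rank \<open>j + 1\<close>, hence these
        four cases. If both are present, \<open>a\<close> is below \<open>b\<close> by
        \<open>far\<close>, and the first step of the way up is a link.\<close>
      consider "a \<in> A" "Suc (rk a) = j" "b \<in> A" "rk b = Suc j"
        | "a \<in> A" "Suc (rk a) = j" "\<not> (b \<in> A \<and> rk b = Suc j)"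
        | "\<not> (a \<in> A \<and> Suc (rk a) = j)" "b \<in> A" "rk b = Suc j"
        | "\<not> (a \<in> A \<and> Suc (rk a) = j)" "\<not> (b \<in> A \<and> rk b = Suc j)" by blast
      then show "\<exists>c\<in>A. rk' c = j \<and> (a, c) \<notin> Q \<and> (c, b) \<notin> Q"
      proof cases
        case 1
        then have "less_in r a b" by (intro far) auto
        from first[OF this] obtain c where "less_in r a c" "rk c = j" "(c, b) \<in> r" using 1 by blast
        then show ?thesis using lA by (intro bexI[of _ c]) (auto simp: rk'_def Q_def less_in_def)
      next
        case 2
        then have "rk a < k" using that by simp
        then obtain c where c: "less_in r a c" "rk c = j" using up[of a] 2 by blast
        have "(a, c) \<notin> Q" "(c, b) \<notin> Q"
          using c 2(3) unfolding Q_def less_in_def by blast+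
        moreover have "c \<in> A" using c(1) lA by blast
        ultimately show ?thesis using c(2) rk'_A by metis
      next
        case 3
        then have "0 < rk b" by simp
        then obtain c where c: "less_in r c b" "rk b = Suc (rk c)" using down[of b] 3(2) by blast
        then have "rk c = j" using 3 by simp
        moreover have "(a, c) \<notin> Q" "(c, b) \<notin> Q"
          using c(1) 3(1) \<open>rk c = j\<close> unfolding Q_def less_in_def by simp_all metis
        moreover have "c \<in> A" using c(1) lA by blast
        ultimately show ?thesis using rk'_A by metis
      next
        case 4
        obtain c where "c \<in> A" "rk c = j" using inhabited[OF jk] by blast
        moreover have "(a, c) \<notin> Q" "(c, b) \<notin> Q"
          using 4 \<open>rk c = j\<close> unfolding Q_def by auto
        ultimately show ?thesis using rk'_A by metis
      qed
    qed
    show "Q \<subseteq> A \<times> A" by (auto simp: Q_def)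
    show "rk' b = Suc (rk' a)" if "(a, b) \<in> Q" for a b using that by (auto simp: Q_def rk'_def)
    show "Domain Q \<inter> Range Q = {}" by (fact disj)
  qed
  then have "(rk', Q) \<in> gap_structures k False A"
    using disj le_k by (auto simp: gap_structures_def rk'_def Q_def)
  moreover have "order_of A (rk', Q) = r"
  proof -
    have "(a, b) \<in> order_of A (rk', Q) \<longleftrightarrow> (a, b) \<in> r" for a b
    proof (cases "a \<in> A \<and> b \<in> A \<and> a \<noteq> b")
      case True
      then have "(a, b) \<in> r \<longleftrightarrow> rk a < rk b \<and> (a, b) \<notin> Q"
        using lt[of a b] far[of a b] unfolding Q_def less_in_def
        by (cases "Suc (rk a) < rk b") auto
      then show ?thesis using True by (auto simp: order_of_def rk'_def)
    qed (use refl rA in \<open>auto simp: order_of_def\<close>)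
    then show ?thesis by auto
  qed
  ultimately show ?thesis by blast
qed

text \<open>The empty poset has no code, because rank 0 would have to be inhabited; it contributes
  the summand 1 of the final formula.\<close>

lemma strongly_graded_bij:
  assumes "finite A" "A \<noteq> {}"
  shows "bij_betw (order_of A) (\<Union>k. gap_structures k False A)
    {r. partial_order_on A r \<and> strongly_graded A r \<and> avoids_3_plus_1 A r}"
  unfolding bij_betw_def
proof (intro conjI subset_antisym)
  show "inj_on (order_of A) (\<Union>k. gap_structures k False A)"
    by (rule inj_on_order_of)
  show "order_of A ` (\<Union>k. gap_structures k False A)
    \<subseteq> {r. partial_order_on A r \<and> strongly_graded A r \<and> avoids_3_plus_1 A r}"
  proof (rule image_subsetI)
    fix s assume "s \<in> (\<Union>k. gap_structures k False A)"
    then obtain rk Q k where "s = (rk, Q)" "(rk, Q) \<in> gap_structures k False A" by (cases s) blast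
    then show "order_of A s \<in>
        {r. partial_order_on A r \<and> strongly_graded A r \<and> avoids_3_plus_1 A r}"
      using partial_order_on_order_of strongly_graded_order_of[OF assms(1)] avoids_order_of by blast
  qed
  show "{r. partial_order_on A r \<and> strongly_graded A r \<and> avoids_3_plus_1 A r}
    \<subseteq> order_of A ` (\<Union>k. gap_structures k False A)"
    using order_of_surj[OF assms] by blast
qed

section \<open>Finiteness and the possible top ranks\<close>

text \<open>Every rank from 1 to \<open>k\<close> is inhabited. The count starts at 1 because rank 0
  may be empty when \<alpha> is set.\<close>

lemma gap_structures_card:
  assumes "finite A" and S: "(rk, Q) \<in> gap_structures k \<alpha> A"
  shows "k \<le> card A"
proof -
  have "{1..k} \<subseteq> rk ` A"
  proof
    fix j assume j: "j \<in> {1..k}"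
    then have "level_ok \<alpha> A rk Q j" using gap_structuresD(6)[OF S] by auto
    then consider "\<exists>f\<in>A. rk f = j" | "layer rk Q j \<noteq> {}" | "layer rk Q (Suc j) \<noteq> {}"
      using j by (auto simp: level_ok_def lgood_def)
    then show "j \<in> rk ` A"
      using gap_structuresD(3)[OF S] gap_structuresD(4)[OF S]
      by cases (fastforce simp: layer_def)+
  qed
  then have "card {1..k} \<le> card A"
    using assms(1) by (meson card_image_le card_mono finite_imageI le_trans)
  then show ?thesis by simp
qed

lemma gap_structures_disjoint:
  assumes "j \<noteq> k"
  shows "gap_structures j False A \<inter> gap_structures k False A = {}"
proof -
  have "k \<le> j" if S: "(rk, Q) \<in> gap_structures j False A" and S': "(rk, Q) \<in> gap_structures k False A"
    for j k rk Q
    using gap_structures_mid[OF S' order_refl] gap_structuresD(2)[OF S] by metis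
  then show ?thesis using assms by (auto intro: antisym)
qed

lemma finite_gap_structures:
  assumes "finite A"
  shows "finite (gap_structures k \<alpha> A)"
proof -
  let ?R = "{f. \<forall>a. (a \<in> A \<longrightarrow> f a \<in> {..k}) \<and> (a \<notin> A \<longrightarrow> f a = 0)} \<times> Pow (A \<times> A)"
  have "gap_structures k \<alpha> A \<subseteq> ?R"
    by (auto simp: gap_structures_def)
  moreover have "finite ?R"
    using assms by (intro finite_SigmaI finite_set_of_finite_funs) auto
  ultimately show ?thesis by (rule finite_subset)
qed

subsection \<open>Removing the bottom rank\<close>

text \<open>The possible gap relations between the bottom rank and the next, with \<open>B\<close>
  the set of all their endpoints.\<close>

definition cores :: "'a set \<Rightarrow> 'a rel set" where
  "cores B = {Q. Domain Q \<inter> Range Q = {} \<and> Field Q = B}"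

text \<open>
  The bottom rank is \<open>F \<union> Domain Q1\<close>; of the next one, \<open>Range Q1\<close> is removed along with it.
\<close>

definition attach :: "'a set \<Rightarrow> 'a set \<Rightarrow> 'a rel \<Rightarrow> ('a \<Rightarrow> nat) \<Rightarrow> 'a \<Rightarrow> nat" where
  "attach A F Q1 rk a = (if a \<notin> A \<or> a \<in> F \<or> a \<in> Domain Q1 then 0
     else if a \<in> Range Q1 then 1 else Suc (rk a))"

text \<open>The upper ends of \<open>Q1\<close> are lower ends of no gap, so \<open>Q\<close> avoids
  them. Rank 1 of the whole is rank 0 of the rest plus these upper ends, and the bit
  \<open>lgood Q1\<close> that they leave becomes the new flag. Rank 0 of the whole sees only
  \<alpha>, \<open>F\<close> and the columns of \<open>Q1\<close>.\<close>

lemma attach_in_gap_structures_iff: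
  assumes F: "F \<subseteq> A" and Q1: "Domain Q1 \<inter> Range Q1 = {}" "Field Q1 \<subseteq> A - F"
    and A': "A' = A - F - Field Q1" and out: "\<And>a. a \<notin> A' \<Longrightarrow> rk a = 0" and Q: "Q \<subseteq> A' \<times> A'"
  shows "(attach A F Q1 rk, Q1 \<union> Q) \<in> gap_structures (Suc k) \<alpha> A \<longleftrightarrow>
    (\<alpha> \<or> F \<noteq> {} \<or> lgood (Q1\<inverse>)) \<and> (rk, Q) \<in> gap_structures k (lgood Q1) A'"
\<comment> \<open>A pair of \<open>Q\<close> that does not join adjacent ranks invalidates both
  sides, so adjacency may be assumed in the main case.\<close>
proof (cases "\<forall>(a, b)\<in>Q. rk b = Suc (rk a)")
  case False
  then obtain a b where ab: "(a, b) \<in> Q" "rk b \<noteq> Suc (rk a)" by blast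
  then have "a \<in> A'" "b \<in> A'" using Q by auto
  then have "attach A F Q1 rk a = Suc (rk a)" "attach A F Q1 rk b = Suc (rk b)"
    by (auto simp: attach_def A' Field_def)
  then have "(attach A F Q1 rk, Q1 \<union> Q) \<notin> gap_structures (Suc k) \<alpha> A"
    using gap_structuresD(4)[of "attach A F Q1 rk" "Q1 \<union> Q" "Suc k" \<alpha> A a b] ab by auto
  moreover have "(rk, Q) \<notin> gap_structures k (lgood Q1) A'"
    using gap_structuresD(4) ab by metis
  ultimately show ?thesis by simp
next
  case True
  let ?rk = "attach A F Q1 rk"
  have rk_F: "?rk a = 0" if "a \<in> F" for a using that by (simp add: attach_def)
  have rk_D: "?rk a = 0" if "a \<in> Domain Q1" for a using that by (simp add: attach_def)
  have rk_R: "?rk a = 1" if "a \<in> Range Q1" for a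
    using that Q1 by (auto simp: attach_def Field_def)
  have rk_A': "?rk a = Suc (rk a)" if "a \<in> A'" for a
    using that by (auto simp: attach_def A' Field_def)
  have cases_A: "a \<in> F \<or> a \<in> Domain Q1 \<or> a \<in> Range Q1 \<or> a \<in> A'" if "a \<in> A" for a
    using that by (auto simp: A' Field_def)
  have A'_sub: "A' \<subseteq> A" "A' \<inter> F = {}" "A' \<inter> Field Q1 = {}" by (auto simp: A')
  have FQ: "Field Q \<subseteq> A'" using Q by (auto simp: Field_def)
  have layer0: "layer ?rk (Q1 \<union> Q) 0 = {}" "layer rk Q 0 = {}"
    using rk_R rk_A' Q True by (fastforce simp: layer_def)+
  have adj: "rk b = Suc (rk a)" if "(a, b) \<in> Q" for a b using True that by blast
  have rkQ: "?rk b = Suc (rk b)" if "(a, b) \<in> Q" for a b using rk_A' Q that by blast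
  have layer1: "layer ?rk (Q1 \<union> Q) (Suc 0) = Q1"
    using rk_R rkQ adj by (fastforce simp: layer_def)
  have layer2: "layer ?rk (Q1 \<union> Q) (Suc (Suc j)) = layer rk Q (Suc j)" for j
    using rk_R rkQ by (fastforce simp: layer_def)
  have free0: "(\<exists>f\<in>A. ?rk f = 0 \<and> f \<notin> Field (Q1 \<union> Q)) \<longleftrightarrow> F \<noteq> {}"
  proof
    assume "\<exists>f\<in>A. ?rk f = 0 \<and> f \<notin> Field (Q1 \<union> Q)"
    then show "F \<noteq> {}" using cases_A rk_R rk_A' by (fastforce simp: Field_def)
  next
    assume "F \<noteq> {}"
    then obtain f where "f \<in> F" by blast
    then have "f \<in> A" "f \<notin> Field (Q1 \<union> Q)"
      using F Q1(2) A'_sub FQ by (auto simp: Field_def)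
    then show "\<exists>f\<in>A. ?rk f = 0 \<and> f \<notin> Field (Q1 \<union> Q)" using rk_F \<open>f \<in> F\<close> by blast
  qed
  have freeS: "(\<exists>f\<in>A. ?rk f = Suc j \<and> f \<notin> Field (Q1 \<union> Q)) \<longleftrightarrow>
      (\<exists>f\<in>A'. rk f = j \<and> f \<notin> Field Q)" for j
  proof
    assume "\<exists>f\<in>A. ?rk f = Suc j \<and> f \<notin> Field (Q1 \<union> Q)"
    then obtain f where f: "f \<in> A" "?rk f = Suc j" "f \<notin> Field Q1" "f \<notin> Field Q"
      by (auto simp: Field_def)
    then have "f \<in> A'" using rk_F[of f] by (auto simp: A')
    then show "\<exists>f\<in>A'. rk f = j \<and> f \<notin> Field Q" using f rk_A' by auto
  next
    assume "\<exists>f\<in>A'. rk f = j \<and> f \<notin> Field Q"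
    then obtain f where "f \<in> A'" "rk f = j" "f \<notin> Field Q" by blast
    then show "\<exists>f\<in>A. ?rk f = Suc j \<and> f \<notin> Field (Q1 \<union> Q)"
      using rk_A' A'_sub by (intro bexI[of _ f]) (auto simp: Field_def)
  qed
  have not_lgood_empty: "\<not> lgood {}" by (simp add: lgood_def)
  have ok0: "level_ok \<alpha> A ?rk (Q1 \<union> Q) 0 \<longleftrightarrow> \<alpha> \<or> F \<noteq> {} \<or> lgood (Q1\<inverse>)"
    unfolding level_ok_def free0 layer0 layer1 using not_lgood_empty by auto
  have okS: "level_ok \<alpha> A ?rk (Q1 \<union> Q) (Suc j) \<longleftrightarrow> level_ok (lgood Q1) A' rk Q j" for j
    unfolding level_ok_def freeS layer2
    by (cases j) (auto simp: layer0 layer1 layer2 not_lgood_empty)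
  have levels: "(\<forall>j\<le>Suc k. level_ok \<alpha> A ?rk (Q1 \<union> Q) j) \<longleftrightarrow>
      (\<alpha> \<or> F \<noteq> {} \<or> lgood (Q1\<inverse>)) \<and> (\<forall>j\<le>k. level_ok (lgood Q1) A' rk Q j)"
    using ok0 okS by (metis Suc_le_mono not0_implies_Suc zero_le)
  have le: "(\<forall>a\<in>A. ?rk a \<le> Suc k) \<longleftrightarrow> (\<forall>a\<in>A'. rk a \<le> k)"
    unfolding attach_def A' by (auto simp: Field_def)
  have "Q1 \<subseteq> Field Q1 \<times> Field Q1" by (auto simp: Field_def)
  then have sub: "Q1 \<union> Q \<subseteq> A \<times> A" using Q Q1(2) A'_sub(1) by blast
  have adjU: "?rk b = Suc (?rk a)" if "(a, b) \<in> Q1 \<union> Q" for a b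
  proof (cases "(a, b) \<in> Q1")
    case True
    then have "?rk a = 0" "?rk b = 1" using rk_D rk_R by blast+
    then show ?thesis by simp
  next
    case False
    then have ab: "(a, b) \<in> Q" using that by blast
    then have "?rk a = Suc (rk a)" using rk_A' Q by blast
    then show ?thesis using rkQ[OF ab] adj[OF ab] by simp
  qed
  have disj: "Domain (Q1 \<union> Q) \<inter> Range (Q1 \<union> Q) = {} \<longleftrightarrow> Domain Q \<inter> Range Q = {}"
  proof -
    have "Domain Q1 \<inter> Range Q = {}" "Domain Q \<inter> Range Q1 = {}"
      using FQ A'_sub(3) unfolding Field_def by blast+
    then show ?thesis using Q1(1) unfolding Domain_Un_eq Range_Un_eq by blast
  qed
  have outA: "\<forall>a. a \<notin> A \<longrightarrow> ?rk a = 0" by (simp add: attach_def)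
  show ?thesis
    unfolding gap_structures_def using sub adjU adj out Q
    by (simp add: levels le disj outA) blast
qed

text \<open>The inverse of \<open>attach\<close>. An element of rank 0 is free or the lower end of a
  gap in \<open>Q1\<close>, so \<open>A'\<close> has only positive ranks and \<open>rk a - 1\<close>
  is never truncated there.\<close>

lemma gap_structures_detach:
  assumes S: "(rk, Q) \<in> gap_structures k \<alpha> A"
  defines "F \<equiv> {a \<in> A. rk a = 0 \<and> a \<notin> Field Q}" and "Q1 \<equiv> layer rk Q 1"
  defines "A' \<equiv> A - F - Field Q1"
  defines "rk' \<equiv> \<lambda>a. if a \<in> A' then rk a - 1 else 0"
  shows "F \<subseteq> A" "Domain Q1 \<inter> Range Q1 = {}" "Field Q1 \<subseteq> A - F" "Q - Q1 \<subseteq> A' \<times> A'"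
    "attach A F Q1 rk' = rk" "Q1 \<union> (Q - Q1) = Q"
proof -
  have adj: "rk b = Suc (rk a)" "a \<in> A" "b \<in> A" if "(a, b) \<in> Q" for a b
    using gap_structuresD(3,4)[OF S] that by blast+
  have disj: "Domain Q \<inter> Range Q = {}" by (rule gap_structuresD(5)[OF S])
  show "F \<subseteq> A" by (auto simp: F_def)
  have Q1Q: "Q1 \<subseteq> Q" by (auto simp: Q1_def layer_def)
  then show "Domain Q1 \<inter> Range Q1 = {}" "Q1 \<union> (Q - Q1) = Q" using disj by blast+
  show "Field Q1 \<subseteq> A - F" using adj Q1Q by (auto simp: Field_def F_def)
  have rk1: "rk a = 0" if "a \<in> Domain Q1" for a using that adj by (fastforce simp: Q1_def layer_def)
  have rk2: "rk a = 1" if "a \<in> Range Q1" for a using that by (auto simp: Q1_def layer_def)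
  show "Q - Q1 \<subseteq> A' \<times> A'"
  proof clarify
    fix a b assume ab: "(a, b) \<in> Q" "(a, b) \<notin> Q1"
    then have "rk b \<noteq> 1" by (auto simp: Q1_def layer_def)
    then have pos: "rk a \<noteq> 0" "rk b \<noteq> 0" "rk b \<noteq> 1" using adj(1)[OF ab(1)] by auto
    have "a \<notin> Field Q1" using pos rk1[of a] Q1Q disj ab by (auto simp: Field_def)
    moreover have "b \<notin> Field Q1" using pos rk1[of b] rk2[of b] by (auto simp: Field_def)
    ultimately show "a \<in> A' \<and> b \<in> A'" using adj(2,3)[OF ab(1)] pos by (auto simp: A'_def F_def)
  qed
  show "attach A F Q1 rk' = rk"
  proof
    fix a
    have zero: "rk a = 0 \<longleftrightarrow> a \<in> F \<or> a \<in> Domain Q1" if "a \<in> A"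
    proof
      assume "rk a = 0"
      moreover have "a \<in> Domain Q1" if "a \<in> Field Q"
        using that adj(1) \<open>rk a = 0\<close> by (fastforce simp: Field_def Q1_def layer_def)
      ultimately show "a \<in> F \<or> a \<in> Domain Q1" using \<open>a \<in> A\<close> by (auto simp: F_def)
    qed (use rk1 in \<open>auto simp: F_def\<close>)
    show "attach A F Q1 rk' a = rk a"
    proof (cases "a \<in> A \<and> rk a \<noteq> 0")
      case True
      then have "a \<notin> F" "a \<notin> Domain Q1" using zero by auto
      then show ?thesis
        using True rk2[of a] by (simp add: attach_def rk'_def A'_def Field_def)
    qed (use zero gap_structuresD(1)[OF S, of a] in \<open>auto simp: attach_def\<close>)
  qed
qed

lemma finite_cores: "finite B \<Longrightarrow> finite (cores B)"
  by (rule finite_subset[of _ "Pow (B \<times> B)"]) (auto simp: cores_def Field_def)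

lemma gap_structures_0:
  "gap_structures 0 \<alpha> A = (if \<alpha> \<or> A \<noteq> {} then {(\<lambda>_. 0, {})} else {})"
proof -
  have "(rk, Q) \<in> gap_structures 0 \<alpha> A \<longleftrightarrow> (\<alpha> \<or> A \<noteq> {}) \<and> rk = (\<lambda>_. 0) \<and> Q = {}" for rk Q
  proof
    assume S: "(rk, Q) \<in> gap_structures 0 \<alpha> A"
    have rk: "rk = (\<lambda>_. 0)" using gap_structuresD(1,2)[OF S] by auto
    moreover have Q: "Q = {}" using gap_structuresD(4)[OF S] rk by auto
    ultimately show "(\<alpha> \<or> A \<noteq> {}) \<and> rk = (\<lambda>_. 0) \<and> Q = {}"
      using gap_structuresD(6)[OF S, of 0] by (auto simp: level_ok_def layer_def lgood_def)
  qed (auto simp: gap_structures_def level_ok_def)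
  then show ?thesis by auto
qed

text \<open>Summing over the field \<open>B\<close> of the core first splits \<open>A\<close> into
  \<open>F\<close>, \<open>B\<close> and the rest, the form that products of exponential generating
  functions count.\<close>

lemma card_gap_structures_Suc:
  assumes "finite A"
  shows "card (gap_structures (Suc k) \<alpha> A) =
    (\<Sum>F\<in>Pow A. \<Sum>B\<in>Pow (A - F). \<Sum>Q\<in>{Q \<in> cores B. \<alpha> \<or> F \<noteq> {} \<or> lgood (Q\<inverse>)}.
      card (gap_structures k (lgood Q) (A - F - B)))"
proof -
  let ?C = "\<lambda>F B. {Q \<in> cores B. \<alpha> \<or> F \<noteq> {} \<or> lgood (Q\<inverse>)}"
  let ?X = "SIGMA F:Pow A. SIGMA B:Pow (A - F). SIGMA Q:?C F B. gap_structures k (lgood Q) (A - F - B)"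
  let ?f = "\<lambda>(F, B, Q1, rk, Q). (attach A F Q1 rk, Q1 \<union> Q)"
  have iff: "(attach A F Q1 rk, Q1 \<union> Q) \<in> gap_structures (Suc k) \<alpha> A"
    if "(F, B, Q1, rk, Q) \<in> ?X" for F B Q1 rk Q
  proof -
    have S: "(rk, Q) \<in> gap_structures k (lgood Q1) (A - F - Field Q1)"
      using that by (auto simp: cores_def)
    show ?thesis
      using attach_in_gap_structures_iff[of F A Q1 _ rk Q k \<alpha>] gap_structuresD(1,3)[OF S] S that
      by (auto simp: cores_def)
  qed
  have "bij_betw ?f ?X (gap_structures (Suc k) \<alpha> A)"
    unfolding bij_betw_def
  proof (intro conjI subset_antisym)
    show "?f ` ?X \<subseteq> gap_structures (Suc k) \<alpha> A"
    proof (rule image_subsetI)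
      fix x assume "x \<in> ?X"
      then show "?f x \<in> gap_structures (Suc k) \<alpha> A" using iff by (cases x) force
    qed
    show "gap_structures (Suc k) \<alpha> A \<subseteq> ?f ` ?X"
    proof clarify
      fix rk Q assume S: "(rk, Q) \<in> gap_structures (Suc k) \<alpha> A"
      define F where "F = {a \<in> A. rk a = 0 \<and> a \<notin> Field Q}"
      define Q1 where "Q1 = layer rk Q 1"
      define A' where "A' = A - F - Field Q1"
      define rk' where "rk' a = (if a \<in> A' then rk a - 1 else 0)" for a
      have rk'_eq: "rk' = (\<lambda>a. if a \<in> A' then rk a - 1 else 0)" by (simp add: rk'_def fun_eq_iff)
      note det = gap_structures_detach[OF S, folded F_def Q1_def, folded A'_def, folded rk'_eq]
      have "(\<alpha> \<or> F \<noteq> {} \<or> lgood (Q1\<inverse>)) \<and> (rk', Q - Q1) \<in> gap_structures k (lgood Q1) A'"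
        using attach_in_gap_structures_iff[OF det(1-3) A'_def _ det(4), of rk' k \<alpha>] det(5,6) S
        by (simp add: rk'_def)
      then have "(F, Field Q1, Q1, rk', Q - Q1) \<in> ?X"
        using det(1-3) by (auto simp: cores_def A'_def)
      moreover have "(rk, Q) = ?f (F, Field Q1, Q1, rk', Q - Q1)" using det(5,6) by simp
      ultimately show "(rk, Q) \<in> ?f ` ?X" by (rule rev_image_eqI)
    qed
    show "inj_on ?f ?X"
    proof -
      define g where "g = (\<lambda>(rk, Q). let F = {a \<in> A. rk a = 0 \<and> a \<notin> Field Q}; Q1 = layer rk Q 1;
        A' = A - F - Field Q1 in
        (F, Field Q1, Q1, \<lambda>a. if a \<in> A' then rk a - (1::nat) else 0, Q - Q1))"
      have "g (?f x) = x" if x: "x \<in> ?X" for x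
      proof -
        obtain F B Q1 rk Q where xe: "x = (F, B, Q1, rk, Q)" by (cases x)
        have B: "B = Field Q1" and FA: "F \<subseteq> A" and Q1: "Domain Q1 \<inter> Range Q1 = {}" "Field Q1 \<subseteq> A - F"
          and S: "(rk, Q) \<in> gap_structures k (lgood Q1) (A - F - Field Q1)"
          using x by (auto simp: xe cores_def)
        have QA: "Q \<subseteq> (A - F - Field Q1) \<times> (A - F - Field Q1)" by (rule gap_structuresD(3)[OF S])
        have out: "a \<notin> A - F - Field Q1 \<Longrightarrow> rk a = 0" for a by (rule gap_structuresD(1)[OF S])
        have adj: "(a, b) \<in> Q \<Longrightarrow> rk b = Suc (rk a)" for a b by (rule gap_structuresD(4)[OF S])
        have at0: "attach A F Q1 rk a = 0 \<longleftrightarrow> a \<notin> A \<or> a \<in> F \<or> a \<in> Domain Q1" for a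
          by (auto simp: attach_def)
        have atR: "attach A F Q1 rk a = 1" if "a \<in> Range Q1" for a
          using that Q1 by (auto simp: attach_def Field_def)
        have atA: "attach A F Q1 rk a = Suc (rk a)" if "a \<in> A - F - Field Q1" for a
          using that by (auto simp: attach_def Field_def)
        have F': "{a \<in> A. attach A F Q1 rk a = 0 \<and> a \<notin> Field (Q1 \<union> Q)} = F"
          using at0 FA Q1(2) QA by (fastforce simp: Field_def)
        have L: "layer (attach A F Q1 rk) (Q1 \<union> Q) 1 = Q1"
        proof -
          have "attach A F Q1 rk b \<noteq> 1" if ab: "(a, b) \<in> Q" for a b
            using atA[of b] QA adj[OF ab] ab by auto
          then show ?thesis using atR by (auto simp: layer_def)
        qed
        have "(\<lambda>a. if a \<in> A - F - Field Q1 then attach A F Q1 rk a - 1 else 0) = rk"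
          using atA out by (auto simp: fun_eq_iff)
        moreover have "Q1 \<union> Q - Q1 = Q" using QA by (auto simp: Field_def)
        ultimately show ?thesis
          unfolding xe g_def Let_def B prod.case F' L by simp
      qed
      then show ?thesis by (rule inj_on_inverseI)
    qed
  qed
  then have "card (gap_structures (Suc k) \<alpha> A) = card ?X" by (simp add: bij_betw_same_card)
  also have "\<dots> = (\<Sum>F\<in>Pow A. \<Sum>B\<in>Pow (A - F). \<Sum>Q\<in>?C F B.
      card (gap_structures k (lgood Q) (A - F - B)))"
  proof -
    let ?S1 = "\<lambda>F B. SIGMA Q:?C F B. gap_structures k (lgood Q) (A - F - B)"
    let ?S2 = "\<lambda>F. SIGMA B:Pow (A - F). ?S1 F B"
    have fin_gs: "finite (gap_structures k \<beta> (A - F - B))" for \<beta> F B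
      using assms by (intro finite_gap_structures) simp
    have fin_C: "finite (?C F B)" if "B \<in> Pow (A - F)" for F B
    proof -
      have "finite B" using that assms finite_subset by blast
      then show ?thesis by (rule rev_finite_subset[OF finite_cores]) blast
    qed
    have fin_S1: "finite (?S1 F B)" if "B \<in> Pow (A - F)" for F B
      by (rule finite_SigmaI[OF fin_C[OF that] fin_gs])
    have fin_S2: "finite (?S2 F)" for F
      by (rule finite_SigmaI[OF _ fin_S1]) (simp add: assms)
    have "card ?X = (\<Sum>F\<in>Pow A. card (?S2 F))"
      by (rule card_SigmaI) (use assms fin_S2 in blast)+
    also have "\<dots> = (\<Sum>F\<in>Pow A. \<Sum>B\<in>Pow (A - F). card (?S1 F B))"
      by (intro sum.cong refl card_SigmaI ballI fin_S1) (use assms in auto)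
    also have "\<dots> = (\<Sum>F\<in>Pow A. \<Sum>B\<in>Pow (A - F). \<Sum>Q\<in>?C F B.
        card (gap_structures k (lgood Q) (A - F - B)))"
      by (intro sum.cong refl card_SigmaI ballI fin_gs fin_C)
    finally show ?thesis .
  qed
  finally show ?thesis .
qed

subsection \<open>Exponential generating functions\<close>

definition egf_count :: "rat fps \<Rightarrow> 'a set \<Rightarrow> rat" where
  "egf_count f A = fact (card A) * fps_nth f (card A)"

text \<open>The exponential generating function of \<open>w\<close> in two variables, with both
  variables set equal. \<open>Psi\<close> is the case \<open>w m n = 2 ^ (m * n)\<close>.\<close>

definition egf2 :: "(nat \<Rightarrow> nat \<Rightarrow> rat) \<Rightarrow> rat fps" where
  "egf2 w = Abs_fps (\<lambda>k. \<Sum>m\<le>k. w m (k - m) / (fact m * fact (k - m)))"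

lemma sum_Pow_card:
  fixes g :: "nat \<Rightarrow> 'b::comm_semiring_1"
  assumes "finite A"
  shows "(\<Sum>S\<in>Pow A. g (card S)) = (\<Sum>k\<le>card A. of_nat (card A choose k) * g k)"
proof -
  have "(\<Sum>S\<in>Pow A. g (card S)) = (\<Sum>k\<le>card A. \<Sum>S | S \<in> Pow A \<and> card S = k. g (card S))"
    using assms by (intro sum.group[symmetric]) (auto intro: card_mono)
  also have "\<dots> = (\<Sum>k\<le>card A. of_nat (card A choose k) * g k)"
    using n_subsets[OF assms] by (intro sum.cong) auto
  finally show ?thesis .
qed

lemma sum_Pow_egf2:
  assumes "finite A"
  shows "(\<Sum>S\<in>Pow A. w (card S) (card (A - S))) = egf_count (egf2 w) A"
proof -
  have "(\<Sum>S\<in>Pow A. w (card S) (card (A - S))) = (\<Sum>S\<in>Pow A. w (card S) (card A - card S))"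
    using assms by (intro sum.cong refl) (auto simp: card_Diff_subset finite_subset)
  also have "\<dots> = (\<Sum>k\<le>card A. of_nat (card A choose k) * w k (card A - k))"
    by (rule sum_Pow_card[OF assms])
  also have "\<dots> = egf_count (egf2 w) A"
    unfolding egf_count_def egf2_def fps_nth_Abs_fps sum_distrib_left
    by (intro sum.cong refl) (auto simp: binomial_fact)
  finally show ?thesis .
qed

lemma egf_count_mult:
  assumes "finite A"
  shows "(\<Sum>S\<in>Pow A. egf_count f S * egf_count g (A - S)) = egf_count (f * g) A"
proof -
  have "egf2 (\<lambda>m n. (fact m * fps_nth f m) * (fact n * fps_nth g n)) = f * g"
    by (auto simp: fps_eq_iff egf2_def fps_mult_nth atLeast0AtMost intro!: sum.cong)
  then show ?thesis
    using sum_Pow_egf2[OF assms, of "\<lambda>m n. (fact m * fps_nth f m) * (fact n * fps_nth g n)"]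
    by (simp add: egf_count_def)
qed

lemma egf2_commute: "egf2 (\<lambda>m n. w n m) = egf2 w"
proof -
  have "(\<Sum>m\<le>k. w (k - m) m / (fact m * fact (k - m))) = (\<Sum>m\<le>k. w m (k - m) / (fact m * fact (k - m)))"
    for k
    by (rule sum.reindex_bij_witness[of _ "\<lambda>m. k - m" "\<lambda>m. k - m"]) (auto simp: mult.commute)
  then show ?thesis by (simp add: egf2_def)
qed

lemma egf2_add: "egf2 (\<lambda>m n. v m n + w m n) = egf2 v + egf2 w"
  by (simp add: fps_eq_iff egf2_def sum.distrib add_divide_distrib)

lemma egf2_diff: "egf2 (\<lambda>m n. v m n - w m n) = egf2 v - egf2 w"
  by (simp add: fps_eq_iff egf2_def sum_subtractf diff_divide_distrib)

text \<open>Choosing \<open>i\<close> of the \<open>m\<close> left elements leaves an unstructured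
  set of \<open>m - i\<close>, whose generating function is the exponential series.\<close>

lemma egf2_binomial_left:
  "egf2 (\<lambda>m n. \<Sum>i\<le>m. of_nat (m choose i) * w i n) = fps_exp 1 * egf2 w"
proof (rule fps_ext)
  fix k
  have "fps_nth (egf2 (\<lambda>m n. \<Sum>i\<le>m. of_nat (m choose i) * w i n)) k =
      (\<Sum>m\<le>k. \<Sum>i\<le>m. w i (k - m) / (fact i * fact (m - i) * fact (k - m)))"
    unfolding egf2_def fps_nth_Abs_fps sum_divide_distrib
    by (intro sum.cong refl) (auto simp: binomial_fact)
  also have "\<dots> = (\<Sum>(m, i)\<in>(SIGMA m:{..k}. {..m}). w i (k - m) / (fact i * fact (m - i) * fact (k - m)))"
    by (rule sum.Sigma) auto
  also have "\<dots> = (\<Sum>(j, i)\<in>(SIGMA j:{..k}. {..k - j}). w i (k - j - i) / (fact j * (fact i * fact (k - j - i))))"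
    by (rule sum.reindex_bij_witness[of _ "\<lambda>(j, i). (j + i, i)" "\<lambda>(m, i). (m - i, i)"])
      (auto simp: mult_ac)
  also have "\<dots> = (\<Sum>j\<le>k. \<Sum>i\<le>k - j. w i (k - j - i) / (fact j * (fact i * fact (k - j - i))))"
    by (rule sum.Sigma[symmetric]) auto
  also have "\<dots> = fps_nth (fps_exp 1 * egf2 w) k"
    by (auto simp: fps_mult_nth egf2_def atLeast0AtMost sum_distrib_left intro!: sum.cong)
  finally show "fps_nth (egf2 (\<lambda>m n. \<Sum>i\<le>m. of_nat (m choose i) * w i n)) k = fps_nth (fps_exp 1 * egf2 w) k" .
qed

lemma egf2_binomial_right:
  "egf2 (\<lambda>m n. \<Sum>j\<le>n. of_nat (n choose j) * w m j) = fps_exp 1 * egf2 w"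
  using egf2_binomial_left[of "\<lambda>m n. w n m"]
    egf2_commute[of "\<lambda>m n. \<Sum>j\<le>n. of_nat (n choose j) * w m j"] egf2_commute[of w]
  by simp

text \<open>The binomial theorem: forbidding one more value for each row divides the series by
  \<open>fps_exp 1\<close>.\<close>

lemma egf2_power_shift:
  "egf2 (\<lambda>m n. (2 ^ n - c) ^ m) = fps_exp 1 * egf2 (\<lambda>m n. (2 ^ n - (c + 1)) ^ m)"
proof -
  have "(2 ^ n - c) ^ m = (\<Sum>i\<le>m. of_nat (m choose i) * (2 ^ n - (c + 1)) ^ i)" for m n
    using binomial_ring[of "2 ^ n - (c + 1)" 1 m] by simp
  then show ?thesis by (simp add: egf2_binomial_left)
qed

lemma Psi_egf2: "Psi = egf2 (\<lambda>m n. (2 ^ n) ^ m)"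
proof -
  have "(\<Sum>(m, n) | m + n = k. 2 ^ (m * n) / (fact m * fact n)) =
      (\<Sum>m\<le>k. (2 ^ (k - m)) ^ m / (fact m * fact (k - m)) :: rat)" for k :: nat
    by (rule sum.reindex_bij_witness[of _ "\<lambda>m. (m, k - m)" fst])
      (auto simp: power_mult[symmetric] mult.commute)
  then show ?thesis by (simp add: Psi_def egf2_def)
qed

subsection \<open>Counting the gaps between two adjacent ranks\<close>

lemma card_rel_rows:
  assumes "finite U" "finite D" "X \<subseteq> Pow D"
  shows "card {Q. Q \<subseteq> U \<times> D \<and> (\<forall>u\<in>U. Q `` {u} \<in> X)} = card X ^ card U"
proof -
  have "bij_betw (\<lambda>f. {(u, d). u \<in> U \<and> d \<in> f u}) (U \<rightarrow>\<^sub>E X)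
      {Q. Q \<subseteq> U \<times> D \<and> (\<forall>u\<in>U. Q `` {u} \<in> X)}"
  proof (rule bij_betw_byWitness[where f' = "\<lambda>Q. \<lambda>u\<in>U. Q `` {u}"])
    show "\<forall>f\<in>U \<rightarrow>\<^sub>E X. (\<lambda>u\<in>U. {(u, d). u \<in> U \<and> d \<in> f u} `` {u}) = f"
      by (auto simp: fun_eq_iff PiE_def extensional_def)
    show "(\<lambda>f. {(u, d). u \<in> U \<and> d \<in> f u}) ` (U \<rightarrow>\<^sub>E X)
        \<subseteq> {Q. Q \<subseteq> U \<times> D \<and> (\<forall>u\<in>U. Q `` {u} \<in> X)}"
    proof (rule image_subsetI)
      fix f assume f: "f \<in> U \<rightarrow>\<^sub>E X"
      have "{(u, d). u \<in> U \<and> d \<in> f u} `` {u} = f u" if "u \<in> U" for u using that by auto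
      moreover have "f u \<in> X" "f u \<subseteq> D" if "u \<in> U" for u
        using that f assms(3) by (auto simp: PiE_def Pi_def)
      ultimately show "{(u, d). u \<in> U \<and> d \<in> f u} \<in> {Q. Q \<subseteq> U \<times> D \<and> (\<forall>u\<in>U. Q `` {u} \<in> X)}"
        by auto
    qed
  qed auto
  then show ?thesis using assms by (simp add: bij_betw_same_card[symmetric] card_PiE)
qed

definition num_full_rels :: "nat \<Rightarrow> nat \<Rightarrow> nat" where
  "num_full_rels m n = card {Q :: (nat \<times> nat) set. Domain Q = {..<m} \<and> Range Q = {..<n}}"

text \<open>Applied to bijections and to their inverses, this shows that the count depends on the
  two cardinalities alone.\<close>

lemma card_full_rels_le:
  assumes "finite U" "finite D" "inj_on f U" "inj_on g D"
  shows "card {Q. Domain Q = U \<and> Range Q = D} \<le> card {Q. Domain Q = f ` U \<and> Range Q = g ` D}"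
proof (rule card_inj_on_le)
  have "inj_on (map_prod f g) (U \<times> D)" using assms by (rule_tac map_prod_inj_on)
  then have "inj_on ((`) (map_prod f g)) (Pow (U \<times> D))" by (rule inj_on_image_Pow)
  then show "inj_on ((`) (map_prod f g)) {Q. Domain Q = U \<and> Range Q = D}"
    by (rule inj_on_subset) auto
  show "(`) (map_prod f g) ` {Q. Domain Q = U \<and> Range Q = D}
      \<subseteq> {Q. Domain Q = f ` U \<and> Range Q = g ` D}"
  proof clarify
    fix Q
    have "Domain (map_prod f g ` Q) = f ` Domain Q" "Range (map_prod f g ` Q) = g ` Range Q"
      by force+
    then show "Domain (map_prod f g ` Q) = f ` Domain Q \<and> Range (map_prod f g ` Q) = g ` Range Q" ..
  qed
  show "finite {Q. Domain Q = f ` U \<and> Range Q = g ` D}"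
    by (rule finite_subset[of _ "Pow (f ` U \<times> g ` D)"]) (use assms in auto)
qed

lemma card_full_rels:
  assumes "finite U" "finite D"
  shows "card {Q. Domain Q = U \<and> Range Q = D} = num_full_rels (card U) (card D)"
proof -
  obtain f g where f: "bij_betw f U {..<card U}" and g: "bij_betw g D {..<card D}"
    using assms ex_bij_betw_finite_nat[OF assms(1)] ex_bij_betw_finite_nat[OF assms(2)]
    by (auto simp: atLeast0LessThan)
  have f': "bij_betw (inv_into U f) {..<card U} U" and g': "bij_betw (inv_into D g) {..<card D} D"
    using f g by (auto intro: bij_betw_inv_into)
  show ?thesis
    unfolding num_full_rels_def
    using card_full_rels_le[OF assms, of f g] f g f' g'
      card_full_rels_le[of "{..<card U}" "{..<card D}" "inv_into U f" "inv_into D g"]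
    by (intro antisym) (auto simp: bij_betw_def)
qed

text \<open>Both sides count the relations without empty rows, on the left sorted by their
  range.\<close>

lemma num_full_rels_sum:
  "(\<Sum>j\<le>n. of_nat (n choose j) * of_nat (num_full_rels m j)) = (2 ^ n - 1 :: rat) ^ m"
proof -
  let ?U = "{..<m}" and ?D = "{..<n}"
  have "{Q. Q \<subseteq> ?U \<times> ?D \<and> (\<forall>u\<in>?U. Q `` {u} \<in> Pow ?D - {{}})} =
      (\<Union>D'\<in>Pow ?D. {Q. Domain Q = ?U \<and> Range Q = D'})"
    by (auto 4 3)
  then have "(2 ^ n - 1) ^ m = card (\<Union>D'\<in>Pow ?D. {Q. Domain Q = ?U \<and> Range Q = D'})"
    using card_rel_rows[of ?U ?D "Pow ?D - {{}}"] by (simp add: card_Pow)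
  also have "\<dots> = (\<Sum>D'\<in>Pow ?D. card {Q. Domain Q = ?U \<and> Range Q = D'})"
  proof (rule card_UN_disjoint)
    show "\<forall>D'\<in>Pow ?D. finite {Q. Domain Q = ?U \<and> Range Q = D'}"
      by (auto intro!: finite_subset[of _ "Pow (?U \<times> ?D)"])
  qed auto
  also have "\<dots> = (\<Sum>D'\<in>Pow ?D. num_full_rels m (card D'))"
    by (intro sum.cong refl) (auto simp: card_full_rels finite_subset)
  also have "\<dots> = (\<Sum>j\<le>n. (n choose j) * num_full_rels m j)"
    using sum_Pow_card[of ?D "num_full_rels m"] by simp
  finally have "of_nat ((2 ^ n - 1) ^ m) = (of_nat (\<Sum>j\<le>n. (n choose j) * num_full_rels m j) :: rat)"
    by simp
  then show ?thesis by (simp add: of_nat_diff)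
qed

lemma card_cores:
  assumes "finite B"
  shows "card {Q \<in> cores B. P Q} = (\<Sum>U\<in>Pow B. card {Q. Domain Q = U \<and> Range Q = B - U \<and> P Q})"
proof -
  have "{Q \<in> cores B. P Q} = (\<Union>U\<in>Pow B. {Q. Domain Q = U \<and> Range Q = B - U \<and> P Q})"
    by (auto simp: cores_def Field_def)
  also have "card \<dots> = (\<Sum>U\<in>Pow B. card {Q. Domain Q = U \<and> Range Q = B - U \<and> P Q})"
  proof (rule card_UN_disjoint)
    show "\<forall>U\<in>Pow B. finite {Q. Domain Q = U \<and> Range Q = B - U \<and> P Q}"
      using assms by (auto intro!: finite_subset[of _ "Pow (B \<times> B)"])
  qed (use assms in auto)
  finally show ?thesis .
qed

lemma card_cores_egf:
  assumes "finite B" "\<And>U D. finite U \<Longrightarrow> finite D \<Longrightarrow>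
    of_nat (card {Q :: 'a rel. Domain Q = U \<and> Range Q = D \<and> P Q}) = w (card U) (card D)"
  shows "of_nat (card {Q \<in> cores (B :: 'a set). P Q}) = egf_count (egf2 w) B"
proof -
  have "of_nat (card {Q \<in> cores B. P Q}) = (\<Sum>U\<in>Pow B. w (card U) (card (B - U)))"
    unfolding card_cores[OF assms(1)] of_nat_sum
    using assms by (intro sum.cong refl) (auto intro!: assms(2) intro: finite_subset)
  then show ?thesis using sum_Pow_egf2[OF assms(1)] by simp
qed

text \<open>Rows nonempty, minus rows nonempty and not full; one full row already forces the whole
  range. For \<open>n = 0\<close> the empty row is the full row, and a relation exists only for
  \<open>m = 0\<close>.\<close>

definition num_left_bad :: "nat \<Rightarrow> nat \<Rightarrow> rat" where
  "num_left_bad m n = (if n = 0 then 0 ^ m else (2 ^ n - 1) ^ m - (2 ^ n - 2) ^ m)"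

lemma card_left_bad:
  assumes "finite U" "finite D"
  shows "of_nat (card {Q. Domain Q = U \<and> Range Q = D \<and> \<not> lgood Q}) = num_left_bad (card U) (card D)"
proof (cases "D = {}")
  case True
  then have "{Q. Domain Q = U \<and> Range Q = D \<and> \<not> lgood Q} = (if U = {} then {{}} else {})"
    by (auto simp: lgood_def)
  then show ?thesis using True assms by (simp add: num_left_bad_def card_gt_0_iff)
next
  case False
  let ?R = "\<lambda>X. {Q. Q \<subseteq> U \<times> D \<and> (\<forall>u\<in>U. Q `` {u} \<in> X)}"
  have fin: "finite (?R X)" for X
    using assms by (auto intro!: finite_subset[of _ "Pow (U \<times> D)"])
  have "card (Pow D - {{}}) = 2 ^ card D - 1"
    using assms card_Diff_singleton[of "{}" "Pow D"] by (simp add: card_Pow)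
  moreover have "card (Pow D - {{}, D}) = 2 ^ card D - 2"
    using False assms card_Diff_subset[of "{{}, D}" "Pow D"] by (simp add: card_Pow)
  ultimately have rows: "card (?R (Pow D - {{}})) = (2 ^ card D - 1) ^ card U"
    "card (?R (Pow D - {{}, D})) = (2 ^ card D - 2) ^ card U"
    using card_rel_rows[OF assms, of "Pow D - {{}}"] card_rel_rows[OF assms, of "Pow D - {{}, D}"]
    by (metis Diff_subset)+
  have split: "{Q. Domain Q = U \<and> Range Q = D \<and> \<not> lgood Q} =
      ?R (Pow D - {{}}) - ?R (Pow D - {{}, D})"
  proof (intro set_eqI iffI)
    fix Q assume "Q \<in> {Q. Domain Q = U \<and> Range Q = D \<and> \<not> lgood Q}"
    then have Q: "Domain Q = U" "Range Q = D" "\<not> lgood Q" by auto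
    then have "\<exists>a\<in>U. Q `` {a} = D" using False unfolding lgood_def by blast
    moreover have "Q \<subseteq> U \<times> D" using Q by auto
    moreover have "\<forall>u\<in>U. Q `` {u} \<noteq> {}" using Q by blast
    ultimately show "Q \<in> ?R (Pow D - {{}}) - ?R (Pow D - {{}, D})" by blast
  next
    fix Q assume Q: "Q \<in> ?R (Pow D - {{}}) - ?R (Pow D - {{}, D})"
    then obtain a where a: "a \<in> U" "Q `` {a} = D" by blast
    have "Domain Q = U" "Range Q = D" using Q a by blast+
    then show "Q \<in> {Q. Domain Q = U \<and> Range Q = D \<and> \<not> lgood Q}"
      using a by (auto simp: lgood_def)
  qed
  have "card (?R (Pow D - {{}}) - ?R (Pow D - {{}, D})) =
      card (?R (Pow D - {{}})) - card (?R (Pow D - {{}, D}))"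
    by (rule card_Diff_subset[OF fin]) blast
  then have c: "card {Q. Domain Q = U \<and> Range Q = D \<and> \<not> lgood Q} =
      (2 ^ card D - 1) ^ card U - (2 ^ card D - 2) ^ card U"
    by (simp only: split rows)
  have "card D \<noteq> 0" using False assms by simp
  then have le: "(2::nat) ^ card D \<ge> 2" using power_increasing[of 1 "card D" "2::nat"] by simp
  then have "(2 ^ card D - 2) ^ card U \<le> (2 ^ card D - (1::nat)) ^ card U"
    by (intro power_mono) auto
  with le have "of_nat (card {Q. Domain Q = U \<and> Range Q = D \<and> \<not> lgood Q}) =
      (of_nat (2 ^ card D - 1) ^ card U - of_nat (2 ^ card D - 2) ^ card U :: rat)"
    unfolding c by (simp only: of_nat_diff of_nat_power)
  moreover have "of_nat (2 ^ card D - 1) = (2 ^ card D - 1 :: rat)"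
    "of_nat (2 ^ card D - 2) = (2 ^ card D - 2 :: rat)"
    using le by (simp_all add: of_nat_diff)
  ultimately show ?thesis using \<open>card D \<noteq> 0\<close> by (simp add: num_left_bad_def)
qed

text \<open>At \<open>m = n = 0\<close> the inclusion-exclusion terms cancel to 0, but the empty
  relation is bad on both sides; the last summand restores it.\<close>

definition num_both_bad :: "nat \<Rightarrow> nat \<Rightarrow> rat" where
  "num_both_bad m n = (2 ^ n) ^ m - (2 ^ n - 1) ^ m - (2 ^ m - 1) ^ n + of_nat (num_full_rels m n)
     + (if m = 0 \<and> n = 0 then 1 else 0)"

text \<open>
  Inclusion--exclusion over relations with some full row and some full column; a relation has
  neither iff its complement in \<open>U \<times> D\<close> has domain \<open>U\<close> and range \<open>D\<close>.
\<close>

lemma card_both_bad: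
  fixes U D :: "'a set"
  assumes "finite U" "finite D"
  shows "of_nat (card {Q. Domain Q = U \<and> Range Q = D \<and> \<not> lgood Q \<and> \<not> lgood (Q\<inverse>)}) =
    num_both_bad (card U) (card D)"
proof -
  define R where "R = {Q. Q \<subseteq> U \<times> D \<and> (\<forall>u\<in>U. Q `` {u} \<in> Pow D - {D})}"
  define C where "C = {Q. Q \<subseteq> U \<times> D \<and> (\<forall>d\<in>D. Q\<inverse> `` {d} \<in> Pow U - {U})}"
  let ?E = "if U = {} \<and> D = {} then {{} :: 'a rel} else {}"
  have sub: "R \<subseteq> Pow (U \<times> D)" "C \<subseteq> Pow (U \<times> D)" by (auto simp: R_def C_def)
  then have fin: "finite R" "finite C" using assms finite_subset by blast+
  have "card R = (2 ^ card D - 1) ^ card U"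
    using card_rel_rows[OF assms, of "Pow D - {D}"] assms
    by (simp add: R_def card_Pow card_Diff_subset)
  then have cR: "of_nat (card R) = (2 ^ card D - 1 :: rat) ^ card U" by (simp add: of_nat_diff)
  have "C = converse ` {Q. Q \<subseteq> D \<times> U \<and> (\<forall>u\<in>D. Q `` {u} \<in> Pow U - {U})}"
  proof (intro set_eqI iffI)
    fix Q assume "Q \<in> C"
    then have "Q\<inverse> \<in> {Q. Q \<subseteq> D \<times> U \<and> (\<forall>u\<in>D. Q `` {u} \<in> Pow U - {U})}" by (auto simp: C_def)
    from imageI[OF this, of converse]
    show "Q \<in> converse ` {Q. Q \<subseteq> D \<times> U \<and> (\<forall>u\<in>D. Q `` {u} \<in> Pow U - {U})}"
      by simp
  qed (auto simp: C_def)
  then have "card C = card {Q. Q \<subseteq> D \<times> U \<and> (\<forall>u\<in>D. Q `` {u} \<in> Pow U - {U})}"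
    by (simp add: card_image inj_on_def)
  also have "\<dots> = (2 ^ card U - 1) ^ card D"
    using card_rel_rows[OF assms(2,1), of "Pow U - {U}"] assms
    by (simp add: card_Pow card_Diff_subset)
  finally have cC: "of_nat (card C) = (2 ^ card U - 1 :: rat) ^ card D" by (simp add: of_nat_diff)
  have "bij_betw (\<lambda>Q. U \<times> D - Q) {Q. Domain Q = U \<and> Range Q = D} (R \<inter> C)"
  proof (rule bij_betw_byWitness[where f' = "\<lambda>Q. U \<times> D - Q"])
    show "(\<lambda>Q. U \<times> D - Q) ` {Q. Domain Q = U \<and> Range Q = D} \<subseteq> R \<inter> C"
      by (fastforce simp: R_def C_def)
    show "(\<lambda>Q. U \<times> D - Q) ` (R \<inter> C) \<subseteq> {Q. Domain Q = U \<and> Range Q = D}"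
    proof (rule image_subsetI)
      fix Q assume Q: "Q \<in> R \<inter> C"
      have "\<exists>d\<in>D. (u, d) \<notin> Q" if "u \<in> U" for u using Q that by (auto simp: R_def)
      moreover have "\<exists>u\<in>U. (u, d) \<notin> Q" if "d \<in> D" for d using Q that by (auto simp: C_def)
      ultimately have "Domain (U \<times> D - Q) = U" "Range (U \<times> D - Q) = D" by blast+
      then show "U \<times> D - Q \<in> {Q. Domain Q = U \<and> Range Q = D}" by simp
    qed
  qed (use sub in auto)
  then have cRC: "card (R \<inter> C) = num_full_rels (card U) (card D)"
    using card_full_rels[OF assms] bij_betw_same_card by fastforce
  have "{Q. Domain Q = U \<and> Range Q = D \<and> \<not> lgood Q \<and> \<not> lgood (Q\<inverse>)} =
      (Pow (U \<times> D) - (R \<union> C)) \<union> ?E"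
  proof (cases "U = {} \<or> D = {}")
    case True
    then have "{} \<in> R \<union> C" by (auto simp: R_def C_def)
    moreover have "U \<times> D = {}" using True by auto
    ultimately have "Pow (U \<times> D) - (R \<union> C) = {}" by auto
    moreover have "{Q. Domain Q = U \<and> Range Q = D \<and> \<not> lgood Q \<and> \<not> lgood (Q\<inverse>)} = ?E"
      using True by (auto simp: lgood_def)
    ultimately show ?thesis by simp
  next
    case False
    show ?thesis
    proof (intro set_eqI iffI)
      fix Q assume "Q \<in> {Q. Domain Q = U \<and> Range Q = D \<and> \<not> lgood Q \<and> \<not> lgood (Q\<inverse>)}"
      then have Q: "Domain Q = U" "Range Q = D" "\<not> lgood Q" "\<not> lgood (Q\<inverse>)" by auto
      then have "\<exists>a\<in>U. Q `` {a} = D" "\<exists>b\<in>D. Q\<inverse> `` {b} = U"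
        using False unfolding lgood_def by (metis Domain_empty_iff Domain_converse Range_converse)+
      moreover have "Q \<subseteq> U \<times> D" using Q by auto
      ultimately show "Q \<in> (Pow (U \<times> D) - (R \<union> C)) \<union> ?E" by (auto simp: R_def C_def)
    next
      fix Q assume "Q \<in> (Pow (U \<times> D) - (R \<union> C)) \<union> ?E"
      then have Q: "Q \<subseteq> U \<times> D" "Q \<notin> R" "Q \<notin> C" using False by auto
      obtain a where a: "a \<in> U" "Q `` {a} = D" using Q by (auto simp: R_def)
      obtain b where b: "b \<in> D" "Q\<inverse> `` {b} = U" using Q by (auto simp: C_def)
      have DR: "Domain Q = U" "Range Q = D" using Q(1) a b by blast+
      then have "\<not> lgood Q" "\<not> lgood (Q\<inverse>)" using a b by (auto simp: lgood_def)
      with DR show "Q \<in> {Q. Domain Q = U \<and> Range Q = D \<and> \<not> lgood Q \<and> \<not> lgood (Q\<inverse>)}" by simp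
    qed
  qed
  moreover have "(Pow (U \<times> D) - (R \<union> C)) \<inter> ?E = {}" by (auto simp: R_def)
  ultimately have "card {Q. Domain Q = U \<and> Range Q = D \<and> \<not> lgood Q \<and> \<not> lgood (Q\<inverse>)} =
      card (Pow (U \<times> D) - (R \<union> C)) + card ?E"
    using assms by (simp add: card_Un_disjoint)
  also have "card (Pow (U \<times> D) - (R \<union> C)) = 2 ^ (card U * card D) - card (R \<union> C)"
    using sub fin assms by (simp add: card_Diff_subset card_Pow card_cartesian_product)
  finally have c: "card {Q. Domain Q = U \<and> Range Q = D \<and> \<not> lgood Q \<and> \<not> lgood (Q\<inverse>)} =
      2 ^ (card U * card D) - card (R \<union> C) + card ?E" .
  have "card (R \<union> C) \<le> card (Pow (U \<times> D))" using sub assms by (intro card_mono) auto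
  then have le: "card (R \<union> C) \<le> 2 ^ (card U * card D)"
    using assms by (simp add: card_Pow card_cartesian_product)
  have "card (R \<union> C) + card (R \<inter> C) = card R + card C"
    using card_Un_Int[OF fin] by simp
  then have "of_nat (card (R \<union> C)) = of_nat (card R) + of_nat (card C) - (of_nat (card (R \<inter> C)) :: rat)"
    by (metis add_diff_cancel_right' of_nat_add)
  then show ?thesis
  proof -
    have "(of_nat (2 ^ (card U * card D) - card (R \<union> C)) :: rat) =
        (2 ^ card D) ^ card U - of_nat (card (R \<union> C))"
      using le by (simp add: of_nat_diff power_mult[symmetric] mult.commute)
    moreover have "(of_nat (card ?E) :: rat) = (if card U = 0 \<and> card D = 0 then 1 else 0)"
      using assms by simp
    moreover have "(of_nat (card {Q. Domain Q = U \<and> Range Q = D \<and> \<not> lgood Q \<and> \<not> lgood (Q\<inverse>)}) :: rat) =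
        of_nat (2 ^ (card U * card D) - card (R \<union> C)) + of_nat (card ?E)"
      by (simp only: c of_nat_add[symmetric])
    ultimately show ?thesis
      using \<open>of_nat (card (R \<union> C)) = _\<close>
      unfolding num_both_bad_def cR cC cRC by linarith
  qed
qed

lemma egf2_if_left: "egf2 (\<lambda>m n. if n = 0 then a m else 0) = Abs_fps (\<lambda>m. a m / fact m)"
proof -
  have "(\<Sum>m\<le>k. (if k - m = 0 then a m else 0) / (fact m * fact (k - m))) = a k / fact k" for k
    by (subst sum.remove[of _ k]) (auto intro!: sum.neutral)
  then show ?thesis by (simp add: egf2_def fps_eq_iff)
qed

lemma egf2_power_minus_1: "egf2 (\<lambda>m n. (2 ^ n - 1) ^ m) = fps_exp (- 1) * Psi"
proof -
  have "Psi = fps_exp 1 * egf2 (\<lambda>m n. (2 ^ n - 1) ^ m)"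
    using egf2_power_shift[of 0] by (simp add: Psi_egf2)
  moreover have "fps_exp (- 1) * fps_exp 1 = (1 :: rat fps)"
    using fps_exp_add_mult[of "- 1 :: rat" 1] by simp
  ultimately show ?thesis by (metis mult.assoc mult_1)
qed

text \<open>Forbidding empty rows and forbidding empty columns each divide \<open>Psi\<close> by
  \<open>fps_exp 1\<close>.\<close>

lemma egf2_full_rels: "egf2 (\<lambda>m n. of_nat (num_full_rels m n)) = fps_exp (- 1) * (fps_exp (- 1) * Psi)"
proof -
  have "fps_exp (- 1) * Psi = fps_exp 1 * egf2 (\<lambda>m n. of_nat (num_full_rels m n))"
    using egf2_binomial_right[of "\<lambda>m n. of_nat (num_full_rels m n)"]
    by (simp add: num_full_rels_sum egf2_power_minus_1)
  moreover have "fps_exp (- 1) * fps_exp 1 = (1 :: rat fps)"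
    using fps_exp_add_mult[of "- 1 :: rat" 1] by simp
  ultimately show ?thesis by (metis mult.assoc mult_1)
qed

lemma egf2_left_bad:
  "egf2 num_left_bad =
     fps_exp (- 1) * Psi - fps_exp (- 1) * (fps_exp (- 1) * Psi) + fps_exp (- 1)"
proof -
  have exp: "fps_exp (- 1) * fps_exp 1 = (1 :: rat fps)"
    using fps_exp_add_mult[of "- 1 :: rat" 1] by simp
  have "egf2 (\<lambda>m n. (2 ^ n - 1) ^ m) = fps_exp 1 * egf2 (\<lambda>m n. (2 ^ n - 2) ^ m)"
    using egf2_power_shift[of 1] by simp
  then have two: "egf2 (\<lambda>m n. (2 ^ n - 2) ^ m) = fps_exp (- 1) * (fps_exp (- 1) * Psi)"
    using exp by (metis egf2_power_minus_1 mult.assoc mult_1)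
  \<comment> \<open>At \<open>n = 0\<close> the difference of powers is
    \<open>0 ^ m - (- 1) ^ m\<close> instead of \<open>0 ^ m\<close>. The correction
    \<open>(- 1) ^ m\<close> produces the summand \<open>fps_exp (- 1)\<close>.\<close>
  have eq: "num_left_bad = (\<lambda>m n. (2 ^ n - 1) ^ m - (2 ^ n - 2) ^ m + (if n = 0 then (- 1) ^ m else 0))"
    by (auto simp: num_left_bad_def fun_eq_iff)
  have "egf2 num_left_bad = egf2 (\<lambda>m n. (2 ^ n - 1) ^ m) - egf2 (\<lambda>m n. (2 ^ n - 2) ^ m)
      + egf2 (\<lambda>m n. if n = 0 then (- 1) ^ m else 0)"
    by (subst eq) (simp only: egf2_add egf2_diff)
  moreover have "Abs_fps (\<lambda>m. (- 1) ^ m / fact m) = fps_exp (- 1 :: rat)"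
    by (simp add: fps_eq_iff)
  ultimately show ?thesis by (simp add: two egf2_power_minus_1 egf2_if_left)
qed

lemma egf2_both_bad:
  "egf2 num_both_bad =
     Psi - 2 * (fps_exp (- 1) * Psi) + fps_exp (- 1) * (fps_exp (- 1) * Psi) + 1"
proof -
  have "egf2 num_both_bad = egf2 (\<lambda>m n. (2 ^ n) ^ m) - egf2 (\<lambda>m n. (2 ^ n - 1) ^ m)
      - egf2 (\<lambda>m n. (2 ^ m - 1) ^ n) + egf2 (\<lambda>m n. of_nat (num_full_rels m n))
      + egf2 (\<lambda>m n. if n = 0 then (if m = 0 then 1 else 0) else 0)"
    unfolding egf2_add[symmetric] egf2_diff[symmetric]
    by (rule arg_cong[of _ _ egf2]) (auto simp: num_both_bad_def fun_eq_iff)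
  moreover have "egf2 (\<lambda>m n. (2 ^ m - 1) ^ n) = fps_exp (- 1) * Psi"
    using egf2_commute[of "\<lambda>m n. (2 ^ n - 1) ^ m"] egf2_power_minus_1 by simp
  moreover have "Abs_fps (\<lambda>m. (if m = 0 then 1 else 0) / fact m) = (1 :: rat fps)"
    by (simp add: fps_eq_iff)
  ultimately show ?thesis
    by (simp add: egf2_if_left egf2_power_minus_1 egf2_full_rels Psi_egf2[symmetric])
qed

lemma card_cores_all:
  fixes B :: "'a set"
  assumes "finite B"
  shows "of_nat (card (cores B)) = egf_count (egf2 (\<lambda>m n. of_nat (num_full_rels m n))) B"
  using card_cores_egf[OF assms, of "\<lambda>_. True" "\<lambda>m n. of_nat (num_full_rels m n)"]
  by (simp add: card_full_rels)

lemma card_cores_left_bad: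
  fixes B :: "'a set"
  assumes "finite B"
  shows "of_nat (card {Q \<in> cores B. \<not> lgood Q}) = egf_count (egf2 num_left_bad) B"
  by (rule card_cores_egf[OF assms card_left_bad])

text \<open>Taking converses preserves \<open>cores B\<close> and exchanges rows and columns, so one
  series serves both sides.\<close>

lemma card_cores_right_bad:
  fixes B :: "'a set"
  assumes "finite B"
  shows "of_nat (card {Q \<in> cores B. \<not> lgood (Q\<inverse>)}) = egf_count (egf2 num_left_bad) B"
proof -
  have "bij_betw converse {Q \<in> cores B. \<not> lgood (Q\<inverse>)} {Q \<in> cores B. \<not> lgood Q}"
    by (rule bij_betw_byWitness[where f' = converse]) (auto simp: cores_def Field_def)
  then show ?thesis using card_cores_left_bad[OF assms] bij_betw_same_card by fastforce
qed

lemma card_cores_both_bad: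
  fixes B :: "'a set"
  assumes "finite B"
  shows "of_nat (card {Q \<in> cores B. \<not> lgood Q \<and> \<not> lgood (Q\<inverse>)}) = egf_count (egf2 num_both_bad) B"
  by (rule card_cores_egf[OF assms card_both_bad])

lemma egf_count_diff: "egf_count (f - g) A = egf_count f A - egf_count g A"
  by (simp add: egf_count_def algebra_simps)

lemma egf_count_add: "egf_count (f + g) A = egf_count f A + egf_count g A"
  by (simp add: egf_count_def algebra_simps)

lemma sum_cores:
  fixes g :: "bool \<Rightarrow> rat"
  assumes "finite B"
  shows "(\<Sum>Q\<in>cores B. g (lgood Q)) =
    egf_count (egf2 (\<lambda>m n. of_nat (num_full_rels m n)) - egf2 num_left_bad) B * g True
      + egf_count (egf2 num_left_bad) B * g False"
proof -
  note fin = finite_cores[OF assms]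
  have split: "card (cores B) = card {Q \<in> cores B. lgood Q} + card {Q \<in> cores B. \<not> lgood Q}"
    using fin by (subst card_Un_disjoint[symmetric]) (auto intro: arg_cong[of _ _ card])
  have "(\<Sum>Q\<in>cores B. g (lgood Q)) = (\<Sum>Q\<in>cores B. if lgood Q then g True else g False)"
    by (intro sum.cong) auto
  also have "\<dots> = of_nat (card {Q \<in> cores B. lgood Q}) * g True
      + of_nat (card {Q \<in> cores B. \<not> lgood Q}) * g False"
    using fin by (simp add: sum.If_cases Int_def)
  finally have s: "(\<Sum>Q\<in>cores B. g (lgood Q)) = of_nat (card {Q \<in> cores B. lgood Q}) * g True
      + of_nat (card {Q \<in> cores B. \<not> lgood Q}) * g False" .
  have "of_nat (card {Q \<in> cores B. lgood Q}) =
      (of_nat (card (cores B)) - of_nat (card {Q \<in> cores B. \<not> lgood Q}) :: rat)"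
    unfolding split by simp
  then show ?thesis
    unfolding s by (simp add: card_cores_all[OF assms] card_cores_left_bad[OF assms] egf_count_diff)
qed

lemma sum_cores_right_bad:
  fixes g :: "bool \<Rightarrow> rat"
  assumes "finite B"
  shows "(\<Sum>Q\<in>{Q \<in> cores B. \<not> lgood (Q\<inverse>)}. g (lgood Q)) =
    egf_count (egf2 num_left_bad - egf2 num_both_bad) B * g True
      + egf_count (egf2 num_both_bad) B * g False"
proof -
  let ?R = "{Q \<in> cores B. \<not> lgood (Q\<inverse>)}"
  have fin: "finite ?R" using finite_cores[OF assms] by simp
  have "card ?R = card ({Q \<in> ?R. lgood Q} \<union> {Q \<in> cores B. \<not> lgood Q \<and> \<not> lgood (Q\<inverse>)})"
    by (rule arg_cong[of _ _ card]) auto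
  then have split: "card ?R = card {Q \<in> ?R. lgood Q} +
      card {Q \<in> cores B. \<not> lgood Q \<and> \<not> lgood (Q\<inverse>)}"
    using finite_cores[OF assms] by (simp add: card_Un_disjoint disjoint_iff)
  have both: "{Q \<in> ?R. \<not> lgood Q} = {Q \<in> cores B. \<not> lgood Q \<and> \<not> lgood (Q\<inverse>)}" by auto
  have "(\<Sum>Q\<in>?R. g (lgood Q)) = (\<Sum>Q\<in>?R. if lgood Q then g True else g False)"
    by (intro sum.cong) auto
  also have "\<dots> = (\<Sum>Q\<in>{Q \<in> ?R. lgood Q}. g True) + (\<Sum>Q\<in>{Q \<in> ?R. \<not> lgood Q}. g False)"
    using fin by (subst sum.If_cases) (auto simp: Int_def intro!: arg_cong2[of _ _ _ _ "(+)"] sum.cong)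
  finally have s: "(\<Sum>Q\<in>?R. g (lgood Q)) = of_nat (card {Q \<in> ?R. lgood Q}) * g True
      + of_nat (card {Q \<in> cores B. \<not> lgood Q \<and> \<not> lgood (Q\<inverse>)}) * g False"
    unfolding both by (simp only: sum_constant)
  have "of_nat (card {Q \<in> ?R. lgood Q}) = (of_nat (card ?R) -
      of_nat (card {Q \<in> cores B. \<not> lgood Q \<and> \<not> lgood (Q\<inverse>)}) :: rat)"
    unfolding split by simp
  then show ?thesis
    unfolding s
    by (simp only: card_cores_right_bad[OF assms] card_cores_both_bad[OF assms] egf_count_diff)
qed

subsection \<open>The linear system\<close>

text \<open>The factor \<open>fps_exp 1\<close> is the free choice of \<open>F\<close>. Cores with
  \<open>lgood Q\<close> lead to the state \<open>True\<close>, the others to \<open>False\<close>.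
  Subtracted are the cases with \<open>F\<close> empty in which the columns of the core are bad
  too.\<close>

fun gap_egf :: "nat \<Rightarrow> bool \<Rightarrow> rat fps" where
  "gap_egf 0 \<alpha> = fps_exp 1 - (if \<alpha> then 0 else 1)"
| "gap_egf (Suc k) \<alpha> =
    fps_exp 1 * ((egf2 (\<lambda>m n. of_nat (num_full_rels m n)) - egf2 num_left_bad) * gap_egf k True
      + egf2 num_left_bad * gap_egf k False)
    - (if \<alpha> then 0 else (egf2 num_left_bad - egf2 num_both_bad) * gap_egf k True
      + egf2 num_both_bad * gap_egf k False)"

lemma egf_count_exp: "egf_count (fps_exp 1) A = 1"
  by (simp add: egf_count_def)

lemma card_gap_structures_egf:
  "finite A \<Longrightarrow> of_nat (card (gap_structures k \<alpha> A)) = egf_count (gap_egf k \<alpha>) A"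
proof (induction k arbitrary: \<alpha> A)
  case 0
  then show ?case by (auto simp: gap_structures_0 egf_count_diff egf_count_exp)
    (auto simp: egf_count_def)
next
  case (Suc k)
  let ?T = "egf2 (\<lambda>m n. of_nat (num_full_rels m n))"
  let ?g = "\<lambda>A \<beta>. egf_count (gap_egf k \<beta>) A"
  let ?good = "(?T - egf2 num_left_bad) * gap_egf k True + egf2 num_left_bad * gap_egf k False"
  let ?bad = "(egf2 num_left_bad - egf2 num_both_bad) * gap_egf k True
    + egf2 num_both_bad * gap_egf k False"
  have fin: "finite B" if "B \<in> Pow (A - F)" for B F
    using that Suc.prems finite_subset by blast
  have all: "(\<Sum>B\<in>Pow C. \<Sum>Q\<in>cores B. ?g (C - B) (lgood Q)) = egf_count ?good C" if "finite C" for C :: "'a set"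
  proof -
    have "(\<Sum>B\<in>Pow C. \<Sum>Q\<in>cores B. ?g (C - B) (lgood Q)) =
        (\<Sum>B\<in>Pow C. egf_count (?T - egf2 num_left_bad) B * ?g (C - B) True
          + egf_count (egf2 num_left_bad) B * ?g (C - B) False)"
      using that finite_subset by (intro sum.cong refl sum_cores) blast
    then show ?thesis
      by (simp only: sum.distrib egf_count_mult[OF that] egf_count_add)
  qed
  have right: "(\<Sum>B\<in>Pow C. \<Sum>Q\<in>{Q \<in> cores B. \<not> lgood (Q\<inverse>)}. ?g (C - B) (lgood Q)) = egf_count ?bad C"
    if "finite C" for C :: "'a set"
  proof -
    have "(\<Sum>B\<in>Pow C. \<Sum>Q\<in>{Q \<in> cores B. \<not> lgood (Q\<inverse>)}. ?g (C - B) (lgood Q)) =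
        (\<Sum>B\<in>Pow C. egf_count (egf2 num_left_bad - egf2 num_both_bad) B * ?g (C - B) True
          + egf_count (egf2 num_both_bad) B * ?g (C - B) False)"
      using that finite_subset by (intro sum.cong refl sum_cores_right_bad) blast
    then show ?thesis
      by (simp only: sum.distrib egf_count_mult[OF that] egf_count_add)
  qed
  \<comment> \<open>The condition on \<open>Q\<close> excludes something only for empty
    \<open>F\<close> and unset flag, so it becomes one correction term and the sum over
    \<open>F\<close> can be a plain product.\<close>
  have inner: "(\<Sum>Q\<in>{Q \<in> cores B. \<alpha> \<or> F \<noteq> {} \<or> lgood (Q\<inverse>)}. g (lgood Q)) =
      (\<Sum>Q\<in>cores B. g (lgood Q)) -
      (if F = {} then if \<alpha> then 0 else \<Sum>Q\<in>{Q \<in> cores B. \<not> lgood (Q\<inverse>)}. g (lgood Q) else 0)"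
    if "finite B" for B F :: "'a set" and g :: "bool \<Rightarrow> rat"
  proof (cases "\<alpha> \<or> F \<noteq> {}")
    case False
    have "cores B = {Q \<in> cores B. lgood (Q\<inverse>)} \<union> {Q \<in> cores B. \<not> lgood (Q\<inverse>)}" by auto
    then have "(\<Sum>Q\<in>cores B. g (lgood Q)) = (\<Sum>Q\<in>{Q \<in> cores B. lgood (Q\<inverse>)}. g (lgood Q))
        + (\<Sum>Q\<in>{Q \<in> cores B. \<not> lgood (Q\<inverse>)}. g (lgood Q))"
      using finite_cores[OF that] by (subst sum.union_disjoint[symmetric]) auto
    then show ?thesis using False by simp
  qed auto
  have "of_nat (card (gap_structures (Suc k) \<alpha> A)) =
      (\<Sum>F\<in>Pow A. \<Sum>B\<in>Pow (A - F). \<Sum>Q\<in>{Q \<in> cores B. \<alpha> \<or> F \<noteq> {} \<or> lgood (Q\<inverse>)}.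
        ?g (A - F - B) (lgood Q))"
    unfolding card_gap_structures_Suc[OF Suc.prems] of_nat_sum
    using Suc by (intro sum.cong refl) simp
  also have "\<dots> = (\<Sum>F\<in>Pow A. \<Sum>B\<in>Pow (A - F). (\<Sum>Q\<in>cores B. ?g (A - F - B) (lgood Q)) -
      (if F = {} then if \<alpha> then 0 else
        \<Sum>Q\<in>{Q \<in> cores B. \<not> lgood (Q\<inverse>)}. ?g (A - F - B) (lgood Q) else 0))"
    using fin by (intro sum.cong refl inner)
  also have "\<dots> = (\<Sum>F\<in>Pow A. egf_count ?good (A - F) -
      (if F = {} then if \<alpha> then 0 else egf_count ?bad A else 0))"
  proof (rule sum.cong[OF refl])
    fix F assume "F \<in> Pow A"
    have "(\<Sum>B\<in>Pow (A - F). (if F = {} then if \<alpha> then 0 else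
        \<Sum>Q\<in>{Q \<in> cores B. \<not> lgood (Q\<inverse>)}. ?g (A - F - B) (lgood Q) else 0)) =
      (if F = {} then if \<alpha> then 0 else egf_count ?bad A else 0)"
      using right[OF Suc.prems] by simp
    then show "(\<Sum>B\<in>Pow (A - F). (\<Sum>Q\<in>cores B. ?g (A - F - B) (lgood Q)) -
        (if F = {} then if \<alpha> then 0 else
          \<Sum>Q\<in>{Q \<in> cores B. \<not> lgood (Q\<inverse>)}. ?g (A - F - B) (lgood Q) else 0)) =
      egf_count ?good (A - F) - (if F = {} then if \<alpha> then 0 else egf_count ?bad A else 0)"
      using all[of "A - F"] Suc.prems by (simp only: sum_subtractf finite_Diff)
  qed
  also have "\<dots> = (\<Sum>F\<in>Pow A. egf_count (fps_exp 1) F * egf_count ?good (A - F))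
      - (if \<alpha> then 0 else egf_count ?bad A)"
    using Suc.prems by (simp only: sum_subtractf egf_count_exp mult_1) (simp add: sum.delta')
  also have "\<dots> = egf_count (gap_egf (Suc k) \<alpha>) A"
    unfolding egf_count_mult[OF Suc.prems] gap_egf.simps egf_count_diff
    by (simp add: egf_count_def)
  finally show ?case .
qed

section \<open>Summation over all top ranks\<close>

text \<open>Makes the sum over all \<open>k\<close> a finite one in each coefficient; read off from
  the counted structures, which have at least \<open>k\<close> elements.\<close>

lemma gap_egf_nth_0:
  assumes "n < k"
  shows "fps_nth (gap_egf k \<alpha>) n = 0"
proof -
  have "gap_structures k \<alpha> {1..n} = {}"
    using gap_structures_card[of "{1..n}" _ _ k \<alpha>] assms by force
  then show ?thesis
    using card_gap_structures_egf[of "{1..n}" k \<alpha>] by (simp add: egf_count_def)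
qed

text \<open>
  The sum of all \<open>g k\<close>, provided that the coefficient of \<open>g k\<close> at \<open>n\<close> vanishes for \<open>n < k\<close>.
\<close>

definition fps_total :: "(nat \<Rightarrow> 'a::comm_ring_1 fps) \<Rightarrow> 'a fps" where
  "fps_total g = Abs_fps (\<lambda>n. \<Sum>k\<le>n. fps_nth (g k) n)"

lemma fps_total_nth:
  assumes "\<And>k n. n < k \<Longrightarrow> fps_nth (g k) n = 0" "n \<le> N"
  shows "fps_nth (fps_total g) n = (\<Sum>k\<le>N. fps_nth (g k) n)"
  unfolding fps_total_def fps_nth_Abs_fps
  by (rule sum.mono_neutral_left) (use assms in auto)

lemma fps_total_add: "fps_total (\<lambda>k. f k + g k) = fps_total f + fps_total g"
  by (simp add: fps_eq_iff fps_total_def sum.distrib)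

lemma fps_total_diff: "fps_total (\<lambda>k. f k - g k) = fps_total f - fps_total g"
  by (simp add: fps_eq_iff fps_total_def sum_subtractf)

text \<open>The convolution meets coefficients at \<open>n - i\<close>, whose sums stop at
  \<open>n - i\<close>. Since later terms vanish, all of them can be extended to the common bound
  \<open>n\<close> and the sums exchanged.\<close>

lemma fps_total_mult:
  assumes "\<And>k n. n < k \<Longrightarrow> fps_nth (g k) n = 0"
  shows "fps_total (\<lambda>k. h * g k) = h * fps_total g"
proof (rule fps_ext)
  fix n
  have "fps_nth (h * fps_total g) n = (\<Sum>i=0..n. \<Sum>k\<le>n. fps_nth h i * fps_nth (g k) (n - i))"
    unfolding fps_mult_nth sum_distrib_left[symmetric]
    by (intro sum.cong refl arg_cong[of _ _ "(*) _"] fps_total_nth[OF assms]) auto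
  also have "\<dots> = (\<Sum>k\<le>n. \<Sum>i=0..n. fps_nth h i * fps_nth (g k) (n - i))"
    by (rule sum.swap)
  finally show "fps_nth (fps_total (\<lambda>k. h * g k)) n = fps_nth (h * fps_total g) n"
    by (simp add: fps_total_def fps_mult_nth)
qed

lemma fps_total_Suc:
  assumes "\<And>k n. n < k \<Longrightarrow> fps_nth (g k) n = 0"
  shows "fps_total g = g 0 + fps_total (\<lambda>k. g (Suc k))"
proof (rule fps_ext)
  fix n
  \<comment> \<open>The bound is \<open>Suc n\<close> because the shifted sum over \<open>k\<close>
    up to \<open>n\<close> reaches \<open>g (Suc n)\<close>.\<close>
  have "fps_nth (fps_total g) n = (\<Sum>k\<le>Suc n. fps_nth (g k) n)"
    by (rule fps_total_nth[OF assms]) auto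
  then show "fps_nth (fps_total g) n = fps_nth (g 0 + fps_total (\<lambda>k. g (Suc k))) n"
    by (simp add: sum.atMost_Suc_shift fps_total_def del: sum.atMost_Suc)
qed

lemma num_strongly_graded_egf:
  "Abs_fps (\<lambda>n. of_nat (num_strongly_graded n) / fact n) = 1 + fps_total (\<lambda>k. gap_egf k False)"
proof (rule fps_ext)
  fix n :: nat
  let ?G = "\<lambda>k. gap_structures k False {1..n}"
  have nth: "fps_nth (gap_egf k \<alpha>) n = of_nat (card (gap_structures k \<alpha> {1..n})) / fact n" for k \<alpha>
    using card_gap_structures_egf[of "{1..n}" k \<alpha>] by (simp add: egf_count_def)
  show "fps_nth (Abs_fps (\<lambda>n. of_nat (num_strongly_graded n) / fact n)) n =
      fps_nth (1 + fps_total (\<lambda>k. gap_egf k False)) n"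
  proof (cases "n = 0")
    case True
    then show ?thesis by (simp add: num_strongly_graded_0 fps_total_def)
  next
    case False
    then have "num_strongly_graded n = card (\<Union>k. ?G k)"
      unfolding num_strongly_graded_def
      using bij_betw_same_card[OF strongly_graded_bij[of "{1..n}"]] by simp
    also have "(\<Union>k. ?G k) = (\<Union>k\<in>{..n}. ?G k)"
      using gap_structures_card[of "{1..n}"] by fastforce
    also have "card \<dots> = (\<Sum>k\<le>n. card (?G k))"
    proof (rule card_UN_disjoint)
      show "\<forall>i\<in>{..n}. \<forall>j\<in>{..n}. i \<noteq> j \<longrightarrow> ?G i \<inter> ?G j = {}"
        using gap_structures_disjoint by blast
    qed (auto simp: finite_gap_structures)
    finally show ?thesis
      using False by (simp add: fps_total_def nth sum_divide_distrib)
  qed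
qed

theorem theorem6p7:
  shows "Abs_fps (\<lambda>n. of_nat (num_strongly_graded n) / fact n) =
    1 + (fps_exp 2 * (2 * fps_exp 1 - 3) + fps_exp 1 * (fps_exp 1 - 2)\<^sup>2 * Psi) /
        (fps_exp 1 * (2 * fps_exp 1 + 1) + (fps_exp 2 - 2 * fps_exp 1 - 1) * Psi)"
proof -
  define E where "E = (fps_exp 1 :: rat fps)"
  define I where "I = (fps_exp (- 1) :: rat fps)"
  define P where "P = Psi"
  define T where "T = egf2 (\<lambda>m n. of_nat (num_full_rels m n))"
  define Tb where "Tb = egf2 num_left_bad"
  define Tbb where "Tbb = egf2 num_both_bad"
  define St where "St = fps_total (\<lambda>k. gap_egf k True)"
  define Sf where "Sf = fps_total (\<lambda>k. gap_egf k False)"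
  have EI: "E * I = 1" using fps_exp_add_mult[of "1 :: rat" "- 1"] by (simp add: E_def I_def)
  have E2: "fps_exp 2 = E * E" using fps_exp_add_mult[of "1 :: rat" 1] by (simp add: E_def)
  have T: "T = I * (I * P)" and Tb: "Tb = I * P - I * (I * P) + I"
    and Tbb: "Tbb = P - 2 * (I * P) + I * (I * P) + 1"
    unfolding T_def Tb_def Tbb_def I_def P_def
    by (rule egf2_full_rels egf2_left_bad egf2_both_bad)+
  note van = gap_egf_nth_0
  have good: "fps_total (\<lambda>k. E * ((T - Tb) * gap_egf k True + Tb * gap_egf k False)) =
      E * ((T - Tb) * St + Tb * Sf)"
    unfolding distrib_left fps_total_add St_def Sf_def mult.assoc[symmetric]
    by (simp only: fps_total_mult[OF van])
  have bad: "fps_total (\<lambda>k. (Tb - Tbb) * gap_egf k True + Tbb * gap_egf k False) =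
      (Tb - Tbb) * St + Tbb * Sf"
    unfolding fps_total_add St_def Sf_def by (simp only: fps_total_mult[OF van])
  have "St = E + fps_total (\<lambda>k. gap_egf (Suc k) True)"
    unfolding St_def by (subst fps_total_Suc[OF van]) (simp_all add: E_def)
  then have St: "St = E + E * ((T - Tb) * St + Tb * Sf)"
    using good by (simp add: E_def T_def Tb_def)
  have "Sf = E - 1 + fps_total (\<lambda>k. gap_egf (Suc k) False)"
    unfolding Sf_def by (subst fps_total_Suc[OF van]) (simp_all add: E_def)
  also have "fps_total (\<lambda>k. gap_egf (Suc k) False) =
      E * ((T - Tb) * St + Tb * Sf) - ((Tb - Tbb) * St + Tbb * Sf)"
    unfolding good[symmetric] bad[symmetric] fps_total_diff[symmetric]
    by (simp add: E_def T_def Tb_def Tbb_def)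
  finally have "Sf = (E + E * ((T - Tb) * St + Tb * Sf)) - 1 - ((Tb - Tbb) * St + Tbb * Sf)"
    by (simp only: diff_conv_add_uminus minus_add_distrib ac_simps)
  \<comment> \<open>\<open>St\<close> and \<open>Sf\<close> differ exactly by the structures whose
    only defect is at rank 0: the empty one for top rank 0, the bad terms otherwise.\<close>
  then have Sf: "Sf = St - 1 - ((Tb - Tbb) * St + Tbb * Sf)" by (simp only: St[symmetric])
  \<comment> \<open>Eliminating \<open>St\<close> leaves \<open>Sf\<close> times the determinant of
    the system; \<open>den\<close> is this determinant times \<open>E * E\<close>, which clears the
    powers of \<open>I\<close>. Its terms in \<open>P * P\<close> cancel. \<open>num\<close> is the
    right-hand side with the same factor.\<close>
  define den where "den = E * (2 * E + 1) + (E * E - 2 * E - 1) * P"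
  define num where "num = E * E * (2 * E - 3) + E * (E - 2)\<^sup>2 * P"
  have "Sf * den = num" using St Sf T Tb Tbb EI unfolding den_def num_def by algebra
  moreover have "fps_nth den 0 = 1"
    using denominator_nth_0 by (simp only: den_def E2 P_def E_def)
  ultimately have "Sf = num / den"
    by (metis fps_nonzero_nth nonzero_mult_div_cancel_right zero_neq_one)
  then show ?thesis
    unfolding num_strongly_graded_egf Sf_def[symmetric]
    by (simp only: num_def den_def E2 P_def E_def)
qed


end
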